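(* Let $\mathbb{D}^{+}$ be the additive semigroup of positive dyadic rational numbers. Let $M$ be the finite sums matrix, i.e. an $\omega\times\omega$ matrix whose rows are all vectors in $\{0,1\}^{\omega}$ with only finitely many, and at least one, nonzero entries. Let $N$ be the Milliken-Taylor matrix determined by the compressed sequence $\langle 1,2\rangle$, i.e. an $\omega\times\omega$ matrix whose rows are all vectors $\vec a\in\mathbb{Q}^{\omega}$ with only finitely many nonzero entries such that $c(\vec a)=\langle 1,2\rangle$. Then: (a) The matrices $M$ and $N$ are image partition regular near zero over $\mathbb{D}^{+}$. (b) The matrix $\begin{pmatrix} M & \mathbf{O}\\ \mathbf{O} & N\end{pmatrix}$ is not image partition regular near zero over $\mathbb{D}^{+}$. (c) The matrix $N$ is not centrally image partition regular near zero over $\mathbb{D}^{+}$.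
   Context: $\omega=\{0,1,2,\ldots\}$. $\mathbb{D}=\{m/2^{t}: m\in\mathbb{Z},\ t\in\omega\}$ and $\mathbb{D}^{+}=\mathbb{D}\cap(0,\infty)$, a dense subsemigroup of $((0,\infty),+)$. For a nonzero vector $\vec a\in\mathbb{Q}^{\omega}$ with only finitely many nonzero entries, $c(\vec a)$ (the compressed form of $\vec a$) is the finite sequence obtained from $\vec a$ by deleting all zeros and then replacing each block of consecutive equal terms by a single term. A finite sequence is compressed if it has no zero terms and no two consecutive equal terms. All matrices have entries in $\mathbb{Q}$ and only finitely many nonzero entries in each row, so that $A\vec x$ is defined. The matrix $\begin{pmatrix} M & \mathbf{O}\\ \mathbf{O} & N\end{pmatrix}$ is the block diagonal matrix with blocks $M$ and $N$ ($\mathbf{O}$ denotes zero matrices); its rows and columns are indexed by two disjoint copies of $\omega$. Let $S$ be a dense subsemigroup of $((0,\infty),+)$. A matrix $A$ with countable column index set $J$ is image partition regular near zero over $S$ if for every finite coloring of $S$ and every $\epsilon>0$ there is $\vec x\in S^{J}$ such that all entries of $A\vec x$ lie in $S\cap(0,\epsilon)$ and have the same color. Let $\beta S_d$ be the Stone-Čech compactification of $S$ with the discrete topology, viewed as the set of ultrafilters on $S$, with the operation given by $B\in p+q$ iff $\{x\in S: -x+B\in q\}\in p$, where $-x+B=\{y\in S: x+y\in B\}$. Let $0^{+}(S)=\{p\in\beta S_d: (0,\epsilon)\cap S\in p \text{ for all } \epsilon>0\}$, a compact right topological subsemigroup of $\beta S_d$. A minimal idempotent of $0^{+}(S)$ is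 an idempotent in the smallest two-sided ideal of $0^{+}(S)$. A set $C\subseteq S$ is central near zero if $C\in p$ for some minimal idempotent $p$ of $0^{+}(S)$. An $\omega\times\omega$ matrix $A$ with rational entries is centrally image partition regular near zero over $S$ if for every $C\subseteq S$ that is central near zero there is $\vec x\in S^{\omega}$ with $A\vec x\in C^{\omega}$. *)

theory Defs
  imports Complex_Main "HOL-Library.Countable"
begin

section \<open>Positive dyadic rationals\<close>

definition dyadic :: "real set" where
  "dyadic = {x. \<exists>(m::int) (t::nat). x = of_int m / 2 ^ t}"

definition dyadic_pos :: "real set" where
  "dyadic_pos = dyadic \<inter> {0<..}"

section \<open>Rational matrices with finitely many nonzero entries in each row\<close>

type_synonym ('i, 'j) rmat = "'i \<Rightarrow> 'j \<Rightarrow> rat"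

text \<open>The sum runs over the support of the row, which is finite for all matrices considered.\<close>

definition mat_apply :: "('i, 'j) rmat \<Rightarrow> ('j \<Rightarrow> real) \<Rightarrow> 'i \<Rightarrow> real" where
  "mat_apply A x i = (\<Sum>j | A i j \<noteq> 0. of_rat (A i j) * x j)"

fun block_diag :: "('i, 'j) rmat \<Rightarrow> ('k, 'l) rmat \<Rightarrow> ('i + 'k, 'j + 'l) rmat" where
  "block_diag M N (Inl i) (Inl j) = M i j"
| "block_diag M N (Inl i) (Inr l) = 0"
| "block_diag M N (Inr k) (Inl j) = 0"
| "block_diag M N (Inr k) (Inr l) = N k l"

definition finitely_supported :: "(nat \<Rightarrow> rat) \<Rightarrow> bool" where
  "finitely_supported a \<longleftrightarrow> finite {n. a n \<noteq> 0}"

definition compressed_form :: "(nat \<Rightarrow> rat) \<Rightarrow> rat list" where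
  "compressed_form a = remdups_adj (map a (sorted_list_of_set {n. a n \<noteq> 0}))"

text \<open>
  The next two predicates fix the set of rows of a matrix, but neither the order in
  which the rows are enumerated nor how often each of them is listed.
\<close>

definition finite_sums_matrix :: "(nat, nat) rmat \<Rightarrow> bool" where
  "finite_sums_matrix M \<longleftrightarrow>
     range M = {a. range a \<subseteq> {0, 1} \<and> finitely_supported a \<and> (\<exists>n. a n \<noteq> 0)}"

definition milliken_taylor_matrix :: "rat list \<Rightarrow> (nat, nat) rmat \<Rightarrow> bool" where
  "milliken_taylor_matrix as N \<longleftrightarrow>
     range N = {a. finitely_supported a \<and> (\<exists>n. a n \<noteq> 0) \<and> compressed_form a = as}"

section \<open>Image partition regularity near zero\<close>

text \<open>
  In the rest of the theory \<open>S\<close> stands for a dense subsemigroup of \<open>((0,\<infinity>),+)\<close>.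
  A finite coloring of \<open>S\<close> is a function taking finitely many values on \<open>S\<close>;
  its values outside \<open>S\<close> are irrelevant.
\<close>

definition ipr_near_zero :: "real set \<Rightarrow> ('i, 'j::countable) rmat \<Rightarrow> bool" where
  "ipr_near_zero S A \<longleftrightarrow>
     (\<forall>(\<chi> :: real \<Rightarrow> nat) (\<epsilon> :: real). finite (\<chi> ` S) \<and> \<epsilon> > 0 \<longrightarrow>
        (\<exists>x. (\<forall>j. x j \<in> S) \<and>
             (\<forall>i. mat_apply A x i \<in> S \<inter> {0<..<\<epsilon>}) \<and>
             (\<exists>c. \<forall>i. \<chi> (mat_apply A x i) = c)))"

section \<open>Ultrafilters on \<open>S\<close> and central sets near zero\<close>

definition ultrafilter_on :: "'a set \<Rightarrow> 'a set set \<Rightarrow> bool" where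
  "ultrafilter_on S p \<longleftrightarrow>
     p \<subseteq> Pow S \<and> S \<in> p \<and> {} \<notin> p \<and>
     (\<forall>A\<in>p. \<forall>B\<in>p. A \<inter> B \<in> p) \<and>
     (\<forall>A\<in>p. \<forall>B. A \<subseteq> B \<and> B \<subseteq> S \<longrightarrow> B \<in> p) \<and>
     (\<forall>A. A \<subseteq> S \<longrightarrow> A \<in> p \<or> S - A \<in> p)"

definition beta :: "'a set \<Rightarrow> 'a set set set" where
  "beta S = {p. ultrafilter_on S p}"

definition beta_add :: "real set \<Rightarrow> real set set \<Rightarrow> real set set \<Rightarrow> real set set" where
  "beta_add S p q = {B. B \<subseteq> S \<and> {x \<in> S. {y \<in> S. x + y \<in> B} \<in> q} \<in> p}"

definition zero_plus :: "real set \<Rightarrow> real set set set" where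
  "zero_plus S = {p \<in> beta S. \<forall>\<epsilon>>0. {0<..<\<epsilon>} \<inter> S \<in> p}"

definition two_sided_ideal :: "real set \<Rightarrow> real set set set \<Rightarrow> bool" where
  "two_sided_ideal S I \<longleftrightarrow>
     I \<noteq> {} \<and> I \<subseteq> zero_plus S \<and>
     (\<forall>p\<in>zero_plus S. \<forall>q\<in>I. beta_add S p q \<in> I \<and> beta_add S q p \<in> I)"

text \<open>
  \<open>LEAST\<close> refers to inclusion. A smallest two-sided ideal exists since
  \<open>0\<^sup>+(S)\<close> is a compact right topological semigroup.
\<close>

definition smallest_ideal :: "real set \<Rightarrow> real set set set" where
  "smallest_ideal S = (LEAST I. two_sided_ideal S I)"

definition minimal_idempotent :: "real set \<Rightarrow> real set set \<Rightarrow> bool" where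
  "minimal_idempotent S p \<longleftrightarrow> p \<in> smallest_ideal S \<and> beta_add S p p = p"

definition central_near_zero :: "real set \<Rightarrow> real set \<Rightarrow> bool" where
  "central_near_zero S C \<longleftrightarrow> C \<subseteq> S \<and> (\<exists>p. minimal_idempotent S p \<and> C \<in> p)"

definition centrally_ipr_near_zero :: "real set \<Rightarrow> (nat, nat) rmat \<Rightarrow> bool" where
  "centrally_ipr_near_zero S A \<longleftrightarrow>
     (\<forall>C. central_near_zero S C \<longrightarrow>
        (\<exists>x. (\<forall>j. x j \<in> S) \<and> (\<forall>i. mat_apply A x i \<in> C)))"

end

theory Submission
  imports Defs
begin

text \<open>
  Both positive statements come from one idempotent \<open>p\<close> of \<open>0\<^sup>+(S)\<close>. A color class that belongs to
  \<open>p\<close> contains all finite sums of some sequence, by the argument of Galvin and Glazer. For the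
  Milliken-Taylor matrix one colors pairs instead: some color \<open>c\<close> is the color of \<open>u + 2 v\<close> for
  \<open>p\<close>-almost all \<open>u\<close> and, given \<open>u\<close>, for \<open>p\<close>-almost all \<open>v\<close>. A single construction,
  \<open>milliken_taylor_sequence\<close>, produces the sequences for both matrices.

  The negative statements rest on a finite coloring of the positive dyadic numbers. Write such a
  number in binary and think of the places of its digits \<open>1\<close>, from the most significant one to the
  least significant one, as a finite list of integers. If \<open>v\<close> is so small that all its digits come
  after those of \<open>u\<close>, then the list of \<open>u + v\<close> is the concatenation of the two lists, and the pairs of
  neighbours in it are those of \<open>u\<close>, those of \<open>v\<close>, and one new pair at the seam. The color of \<open>z\<close>
  records the parity \<open>s\<close> of its first place, the parity \<open>e\<close> of its last place, and the parity \<open>b\<close>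
  of the number of neighbours whose left member has parity \<open>e\<close> and whose right member has parity
  \<open>s\<close>.

  A sequence whose finite sums are bounded has arbitrarily small terms, hence a subsequence in which
  the digits of each term come after those of all earlier ones (\<open>far_subsequence\<close>).
  If \<open>u\<close>, \<open>v\<close> and \<open>u + v\<close> have the same color and \<open>v\<close> comes after \<open>u\<close>, the seam of
  \<open>u + v\<close> is itself of the counted kind, so the count \<open>n\<close> modulo 2 satisfies \<open>n = n + n + 1\<close>, and \<open>b\<close> is odd (\<open>seam_color_sum\<close>). In a
  Milliken-Taylor system for \<open>\<langle>1,2\<rangle>\<close> the first place of the sum is that of a term \<open>y\<^sub>i\<close>
  and the last place that of a double \<open>2 y\<^sub>j\<close>. Doubling shifts all places by one, so the terms
  \<open>y\<^sub>i\<close> end with the wrong parity and the doubles \<open>2 y\<^sub>j\<close> start with the wrong parity: no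
  seam in \<open>y\<^sub>1 + y\<^sub>2 + 2 y\<^sub>3\<close> or \<open>y\<^sub>1 + 2 y\<^sub>2 + 2 y\<^sub>3\<close> is counted. The count is therefore additive on
  such sums, and comparing them shows that \<open>b\<close> is even (\<open>seam_color_milliken_taylor\<close>). Hence no
  color class contains bounded systems of both kinds, as the block diagonal matrix would require.
  Every member of an idempotent of \<open>0\<^sup>+(S)\<close> contains \<open>u\<close>, \<open>v\<close> and \<open>u + v\<close> with \<open>v\<close> as small as
  desired, so a color class that is central near zero contains no bounded Milliken-Taylor system.

  The last step needs a central set, that is, a minimal idempotent. Its existence is the theory of
  compact right topological semigroups for \<open>0\<^sup>+(S)\<close>: a minimal closed left ideal \<open>L\<close> exists, the
  smallest two-sided ideal is \<open>L + 0\<^sup>+(S)\<close>, and \<open>L\<close> contains an idempotent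
  (\<open>minimal_idempotent_exists\<close>).
\<close>

section \<open>Compactness of the space of ultrafilters\<close>

lemma ultrafilterD:
  assumes "p \<in> beta S"
  shows ultrafilter_Int: "A \<in> p \<Longrightarrow> B \<in> p \<Longrightarrow> A \<inter> B \<in> p"
    and ultrafilter_mono: "A \<in> p \<Longrightarrow> A \<subseteq> B \<Longrightarrow> B \<subseteq> S \<Longrightarrow> B \<in> p"
    and ultrafilter_whole: "S \<in> p"
    and ultrafilter_empty: "{} \<notin> p"
    and ultrafilter_subset: "A \<in> p \<Longrightarrow> A \<subseteq> S"
    and ultrafilter_compl: "A \<subseteq> S \<Longrightarrow> A \<notin> p \<Longrightarrow> S - A \<in> p"
proof -
  have u: "p \<subseteq> Pow S" "S \<in> p" "{} \<notin> p" "\<forall>A\<in>p. \<forall>B\<in>p. A \<inter> B \<in> p"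
    "\<forall>A\<in>p. \<forall>B. A \<subseteq> B \<and> B \<subseteq> S \<longrightarrow> B \<in> p" "\<forall>A. A \<subseteq> S \<longrightarrow> A \<in> p \<or> S - A \<in> p"
    using assms unfolding beta_def ultrafilter_on_def mem_Collect_eq by simp_all
  show "A \<in> p \<Longrightarrow> B \<in> p \<Longrightarrow> A \<inter> B \<in> p" using u(4) by simp
  show "A \<in> p \<Longrightarrow> A \<subseteq> B \<Longrightarrow> B \<subseteq> S \<Longrightarrow> B \<in> p" using u(5) by metis
  show "S \<in> p" "{} \<notin> p" by (fact u)+
  show "A \<in> p \<Longrightarrow> A \<subseteq> S" using u(1) by blast
  show "A \<subseteq> S \<Longrightarrow> A \<notin> p \<Longrightarrow> S - A \<in> p" using u(6) by metis
qed

lemma ultrafilter_not_both: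
  assumes "p \<in> beta S" "A \<in> p" shows "S - A \<notin> p"
proof
  assume "S - A \<in> p"
  then have "A \<inter> (S - A) \<in> p" by (rule ultrafilter_Int[OF assms])
  then show False using ultrafilter_empty[OF assms(1)] by auto
qed

lemma ultrafilter_nonempty: "p \<in> beta S \<Longrightarrow> A \<in> p \<Longrightarrow> \<exists>x. x \<in> A"
  by (metis ultrafilter_empty equals0I)

lemma ultrafilter_Inter:
  assumes "p \<in> beta S" "finite F" "F \<subseteq> p" shows "S \<inter> \<Inter>F \<in> p"
  using assms(2,3)
proof (induction F rule: finite_induct)
  case empty then show ?case using ultrafilter_whole[OF assms(1)] by simp
next
  case (insert A F)
  then have "A \<inter> (S \<inter> \<Inter>F) \<in> p" by (auto intro: ultrafilter_Int[OF assms(1)])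
  then show ?case by (simp add: Int_left_commute)
qed

lemma ultrafilter_eqI:
  assumes "p \<in> beta S" "q \<in> beta S" "p \<subseteq> q" shows "p = q"
proof
  show "q \<subseteq> p"
  proof
    fix A assume A: "A \<in> q"
    have "S - A \<notin> p" using ultrafilter_not_both[OF assms(2) A] assms(3) by auto
    then show "A \<in> p"
      using ultrafilter_compl[OF assms(1) ultrafilter_subset[OF assms(2) A]] by auto
  qed
qed (fact assms(3))

lemma ultrafilter_finite_coloring:
  assumes p: "p \<in> beta S" and fin: "finite (\<chi> ` S)"
  shows "\<exists>c. {x \<in> S. \<chi> x = c} \<in> p"
proof (rule ccontr)
  assume "\<not> ?thesis"
  then have "S - {x \<in> S. \<chi> x = c} \<in> p" for c
    by (intro ultrafilter_compl[OF p] Collect_subset) simp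
  then have "S \<inter> \<Inter>((\<lambda>c. S - {x \<in> S. \<chi> x = c}) ` \<chi> ` S) \<in> p"
    by (intro ultrafilter_Inter[OF p] finite_imageI fin) auto
  moreover have "S \<inter> \<Inter>((\<lambda>c. S - {x \<in> S. \<chi> x = c}) ` \<chi> ` S) = {}" by auto
  ultimately show False using ultrafilter_empty[OF p] by simp
qed

text \<open>
  Intersecting with \<open>S\<close> lets the empty subfamily count as well: it forces \<open>S \<noteq> {}\<close>.
\<close>

definition fip :: "'a set \<Rightarrow> 'a set set \<Rightarrow> bool" where
  "fip S \<A> \<longleftrightarrow> \<A> \<subseteq> Pow S \<and> (\<forall>F. finite F \<and> F \<subseteq> \<A> \<longrightarrow> S \<inter> \<Inter>F \<noteq> {})"

lemma fipD: "fip S \<A> \<Longrightarrow> finite F \<Longrightarrow> F \<subseteq> \<A> \<Longrightarrow> \<exists>x\<in>S. \<forall>A\<in>F. x \<in> A"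
  unfolding fip_def by (metis Int_iff Inter_iff equals0I)

text \<open>
  If finite subfamilies \<open>F\<close> and \<open>G\<close> refute the two extensions, then the members of \<open>F \<union> G\<close> that lie in
  \<open>\<A>\<close> have a common point. It lies in \<open>B\<close> or in \<open>S - B\<close>, hence in all members of \<open>F\<close> or
  in all members of \<open>G\<close>.
\<close>

lemma fip_insert_or_compl:
  assumes A: "fip S \<A>" and B: "B \<subseteq> S"
  shows "fip S (insert B \<A>) \<or> fip S (insert (S - B) \<A>)"
proof (rule ccontr)
  assume n: "\<not> ?thesis"
  have sub: "insert B \<A> \<subseteq> Pow S" "insert (S - B) \<A> \<subseteq> Pow S"
    using A B by (auto simp: fip_def)
  obtain F where F: "finite F" "F \<subseteq> insert B \<A>" "S \<inter> \<Inter>F = {}"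
    using n sub unfolding fip_def by metis
  obtain G where G: "finite G" "G \<subseteq> insert (S - B) \<A>" "S \<inter> \<Inter>G = {}"
    using n sub unfolding fip_def by metis
  have "finite ((F - {B}) \<union> (G - {S - B}))" "(F - {B}) \<union> (G - {S - B}) \<subseteq> \<A>"
    using F(1,2) G(1,2) by auto
  from fipD[OF A this] obtain x
    where x: "x \<in> S" "\<And>A. A \<in> F \<Longrightarrow> A \<noteq> B \<Longrightarrow> x \<in> A" "\<And>A. A \<in> G \<Longrightarrow> A \<noteq> S - B \<Longrightarrow> x \<in> A"
    by auto
  have "x \<in> S \<inter> \<Inter>F \<or> x \<in> S \<inter> \<Inter>G"
    using x by (cases "x \<in> B") (simp_all, metis, metis DiffI)
  then show False using F(3) G(3) by simp
qed

text \<open>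
  A maximal family with the finite intersection property decides every subset of \<open>S\<close> by
  \<open>fip_insert_or_compl\<close>, and a family with this property that decides every set is an ultrafilter.
\<close>

lemma fip_extends_to_ultrafilter:
  assumes "fip S \<A>"
  shows "\<exists>p\<in>beta S. \<A> \<subseteq> p"
proof -
  let ?E = "{\<B>. \<A> \<subseteq> \<B> \<and> fip S \<B>}"
  have "\<exists>p\<in>?E. \<forall>\<B>\<in>?E. p \<subseteq> \<B> \<longrightarrow> \<B> = p"
  proof (rule subset_Zorn_nonempty)
    show "?E \<noteq> {}" using assms by blast
  next
    fix \<C> assume C: "\<C> \<noteq> {}" "subset.chain ?E \<C>"
    have "S \<inter> \<Inter>F \<noteq> {}" if F: "finite F" "F \<subseteq> \<Union>\<C>" for F
    proof -
      from finite_subset_Union_chain[OF F C] obtain \<B> where "\<B> \<in> \<C>" "F \<subseteq> \<B>" by blast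
      then have "fip S \<B>" using C(2) by (auto simp: subset_chain_def)
      from fipD[OF this F(1) \<open>F \<subseteq> \<B>\<close>] show ?thesis by auto
    qed
    moreover have "\<A> \<subseteq> \<B> \<and> \<B> \<subseteq> Pow S" if "\<B> \<in> \<C>" for \<B>
      using C(2) that by (auto simp: subset_chain_def fip_def)
    then have "\<A> \<subseteq> \<Union>\<C>" "\<Union>\<C> \<subseteq> Pow S" using C(1) by (metis Sup_upper2 ex_in_conv, metis Sup_least)
    ultimately show "\<Union>\<C> \<in> ?E" by (simp add: fip_def)
  qed
  then obtain p where p: "\<A> \<subseteq> p" "fip S p"
    and max: "\<And>\<B>. p \<subseteq> \<B> \<Longrightarrow> fip S \<B> \<Longrightarrow> \<B> = p"
    by (smt (verit) mem_Collect_eq subset_trans)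
  have dec: "B \<in> p \<or> S - B \<in> p" if "B \<subseteq> S" for B
    using fip_insert_or_compl[OF p(2) that] max by (metis insertI1 subset_insertI)
  have meet: "S \<inter> \<Inter>F \<noteq> {}" if "finite F" "F \<subseteq> p" for F
    using p(2) that by (simp add: fip_def)
  have sub: "p \<subseteq> Pow S" using p(2) by (simp add: fip_def)
  have "ultrafilter_on S p"
    unfolding ultrafilter_on_def
  proof (intro conjI ballI allI impI)
    show "p \<subseteq> Pow S" by (fact sub)
    show e: "{} \<notin> p" using meet[of "{{}}"] by auto
    show "S \<in> p" using dec[of S] e by auto
    show "A \<inter> B \<in> p" if "A \<in> p" "B \<in> p" for A B
      using dec[of "A \<inter> B"] meet[of "{A, B, S - A \<inter> B}"] that sub by auto
    show "B \<in> p" if "A \<in> p" "A \<subseteq> B \<and> B \<subseteq> S" for A B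
      using dec[of B] meet[of "{A, S - B}"] that by auto
    show "A \<in> p \<or> S - A \<in> p" if "A \<subseteq> S" for A using dec that by blast
  qed
  then show ?thesis using p(1) by (auto simp: beta_def)
qed

text \<open>
  This is compactness of \<open>\<beta>S\<close>: the requirement \<open>A \<in> p\<close> cuts out a basic clopen set, and a family of
  such sets has a common point as soon as all its finite subfamilies do.
\<close>

lemma ultrafilter_compactness:
  assumes "\<And>F. finite F \<Longrightarrow> F \<subseteq> \<A> \<Longrightarrow> \<exists>p\<in>beta S. F \<subseteq> p"
  shows "\<exists>p\<in>beta S. \<A> \<subseteq> p"
proof (rule fip_extends_to_ultrafilter)
  show "fip S \<A>"
    unfolding fip_def
  proof (intro conjI subsetI allI impI)
    show "A \<in> Pow S" if "A \<in> \<A>" for A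
      using assms[of "{A}"] that ultrafilter_subset by fastforce
    show "S \<inter> \<Inter>F \<noteq> {}" if "finite F \<and> F \<subseteq> \<A>" for F
      using assms[of F] that ultrafilter_Inter ultrafilter_empty by metis
  qed
qed

text \<open>
  These are the closed sets of the Stone topology of \<open>\<beta>S\<close>, as the intersections of basic clopen sets
  \<open>{p. A \<in> p}\<close>. Describing a closed set by a family of subsets of \<open>S\<close> reduces all compactness arguments
  to \<open>ultrafilter_compactness\<close>.
\<close>

definition uf_closed :: "'a set \<Rightarrow> 'a set set set \<Rightarrow> bool" where
  "uf_closed S K \<longleftrightarrow> (\<exists>\<A>. K = {p \<in> beta S. \<A> \<subseteq> p})"

lemma uf_closed_Inter:
  assumes "\<And>K. K \<in> \<K> \<Longrightarrow> uf_closed S K" "\<K> \<noteq> {}"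
  shows "uf_closed S (\<Inter>\<K>)"
proof -
  have "\<forall>K\<in>\<K>. \<exists>\<A>. K = {p \<in> beta S. \<A> \<subseteq> p}"
    using assms(1) by (auto simp: uf_closed_def)
  then obtain a where a: "\<And>K. K \<in> \<K> \<Longrightarrow> K = {p \<in> beta S. a K \<subseteq> p}" by metis
  have "\<Inter>\<K> = {p \<in> beta S. (\<Union>K\<in>\<K>. a K) \<subseteq> p}"
    using a assms(2) by blast
  then show ?thesis unfolding uf_closed_def by blast
qed

text \<open>
  A closed set is determined by the subsets of \<open>S\<close> that all its points share, so the family that defines
  it can be chosen canonically.
\<close>

lemma uf_closed_common:
  assumes "uf_closed S K"
  shows "K = {p \<in> beta S. \<Inter>K \<subseteq> p}"
proof -
  obtain \<A> where A: "K = {p \<in> beta S. \<A> \<subseteq> p}" using assms unfolding uf_closed_def by auto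
  then have sub: "\<A> \<subseteq> \<Inter>K" by auto
  have "p \<in> K" if "p \<in> beta S" "\<Inter>K \<subseteq> p" for p
    using that(1) subset_trans[OF sub that(2)] by (simp add: A)
  moreover have "p \<in> beta S \<and> \<Inter>K \<subseteq> p" if "p \<in> K" for p
    using that A by (auto simp: Inter_lower)
  ultimately show ?thesis by auto
qed

lemma uf_closed_chain_nonempty:
  assumes "\<C> \<noteq> {}" "\<And>K. K \<in> \<C> \<Longrightarrow> uf_closed S K \<and> K \<noteq> {}"
    and chain: "\<And>K L. K \<in> \<C> \<Longrightarrow> L \<in> \<C> \<Longrightarrow> K \<subseteq> L \<or> L \<subseteq> K"
  shows "\<Inter>\<C> \<noteq> {}"
proof -
  have "\<exists>p\<in>beta S. (\<Union>K\<in>\<C>. \<Inter>K) \<subseteq> p"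
  proof (rule ultrafilter_compactness)
    fix F assume F: "finite F" "F \<subseteq> (\<Union>K\<in>\<C>. \<Inter>K)"
    have ch: "subset.chain UNIV (Inter ` \<C>)"
      unfolding subset_chain_def by (simp, metis chain Inter_anti_mono)
    have "Inter ` \<C> \<noteq> {}" using assms(1) by simp
    from finite_subset_Union_chain[OF F this ch]
    obtain K where K: "K \<in> \<C>" "F \<subseteq> \<Inter>K" by (metis imageE)
    then obtain p where "p \<in> K" "p \<in> beta S"
      using assms(2)[of K] unfolding uf_closed_def by auto
    then show "\<exists>p\<in>beta S. F \<subseteq> p" using K(2) by auto
  qed
  then obtain p where p: "p \<in> beta S" "(\<Union>K\<in>\<C>. \<Inter>K) \<subseteq> p" by auto
  have "p \<in> K" if K: "K \<in> \<C>" for K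
  proof -
    have "\<Inter>K \<subseteq> p" using p(2) K by (metis UN_subset_iff)
    then have "p \<in> {p \<in> beta S. \<Inter>K \<subseteq> p}" using p(1) by simp
    then show ?thesis using uf_closed_common[of S K] assms(2)[OF K] by metis
  qed
  then show ?thesis by blast
qed

text \<open>
  Zorn's lemma for nonempty closed sets, ordered by reverse inclusion: compactness keeps the
  intersection of a chain nonempty. It yields both the minimal left ideals and the minimal closed
  subsemigroups below.
\<close>

lemma minimal_closed_set:
  assumes "\<F> \<noteq> {}" "\<And>K. K \<in> \<F> \<Longrightarrow> uf_closed S K \<and> K \<noteq> {}"
    and Int: "\<And>\<C>. \<C> \<noteq> {} \<Longrightarrow> \<C> \<subseteq> \<F> \<Longrightarrow> \<Inter>\<C> \<noteq> {} \<Longrightarrow> \<Inter>\<C> \<in> \<F>"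
  shows "\<exists>K\<in>\<F>. \<forall>L\<in>\<F>. L \<subseteq> K \<longrightarrow> L = K"
proof -
  \<comment> \<open>Passing to complements turns minimal sets into maximal ones.\<close>
  have "\<exists>M\<in>uminus ` \<F>. \<forall>X\<in>uminus ` \<F>. M \<subseteq> X \<longrightarrow> X = M"
  proof (rule subset_Zorn_nonempty)
    show "uminus ` \<F> \<noteq> {}" using assms(1) by blast
  next
    fix \<C> assume C: "\<C> \<noteq> {}" "subset.chain (uminus ` \<F>) \<C>"
    let ?D = "uminus ` \<C>"
    have D: "?D \<noteq> {}" "?D \<subseteq> \<F>"
      using C by (auto simp: subset_chain_def)
    have "\<Inter>?D \<noteq> {}"
    proof (rule uf_closed_chain_nonempty[OF D(1)])
      show "uf_closed S K \<and> K \<noteq> {}" if "K \<in> ?D" for K using assms(2) D(2) that by blast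
      show "K \<subseteq> L \<or> L \<subseteq> K" if "K \<in> ?D" "L \<in> ?D" for K L
        using that C(2) unfolding subset_chain_def by blast
    qed
    then have "\<Inter>?D \<in> \<F>" by (rule Int[OF D])
    moreover have "\<Union>\<C> = - \<Inter>?D" by auto
    ultimately show "\<Union>\<C> \<in> uminus ` \<F>" by blast
  qed
  then obtain K where K: "K \<in> \<F>" "\<And>L. L \<in> \<F> \<Longrightarrow> - K \<subseteq> - L \<Longrightarrow> - L = - K" by auto
  show ?thesis
  proof (intro bexI[OF _ K(1)] ballI impI)
    fix L assume "L \<in> \<F>" "L \<subseteq> K"
    then have "- L = - K" by (intro K(2)) auto
    then show "L = K" by simp
  qed
qed

section \<open>Semigroups with arbitrarily small elements\<close>

text \<open>
  A row of the Milliken-Taylor matrix for \<open>\<langle>1,2\<rangle>\<close> is given by the set \<open>F\<close> of columns with entry 1 and the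
  set \<open>G\<close> of columns with entry 2.
\<close>

definition block_pair :: "nat set \<Rightarrow> nat set \<Rightarrow> bool" where
  "block_pair F G \<longleftrightarrow> finite F \<and> F \<noteq> {} \<and> finite G \<and> G \<noteq> {} \<and> (\<forall>i\<in>F. \<forall>j\<in>G. i < j)"

text \<open>
  Accumulation at zero makes \<open>0\<^sup>+(S)\<close> nonempty. Every dense subsemigroup of \<open>(0,\<infinity>)\<close> is an
  instance.
\<close>

locale semigroup_near_zero =
  fixes S :: "real set"
  assumes pos: "x \<in> S \<Longrightarrow> 0 < x"
    and add_closed: "x \<in> S \<Longrightarrow> y \<in> S \<Longrightarrow> x + y \<in> S"
    and small_elements: "0 < \<epsilon> \<Longrightarrow> \<exists>x\<in>S. x < \<epsilon>"
begin

abbreviation plus (infixl "\<oplus>" 65) where "p \<oplus> q \<equiv> beta_add S p q"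

text \<open>
  The set of all \<open>x\<close> with \<open>-x + B \<in> q\<close>. Thus \<open>B \<in> p + q\<close> means \<open>shifts_into q B \<in> p\<close>; this
  condition on \<open>p\<close> is a basic clopen set, so addition is continuous in its left argument.
\<close>

definition shifts_into :: "real set set \<Rightarrow> real set \<Rightarrow> real set" where
  "shifts_into q B = {x \<in> S. {y \<in> S. x + y \<in> B} \<in> q}"

lemma mem_plus: "B \<in> p \<oplus> q \<longleftrightarrow> B \<subseteq> S \<and> shifts_into q B \<in> p"
  by (simp add: beta_add_def shifts_into_def)

lemma shifts_into_Int:
  assumes "q \<in> beta S"
  shows "shifts_into q (A \<inter> B) = shifts_into q A \<inter> shifts_into q B"
proof -
  have "{y \<in> S. x + y \<in> A \<inter> B} \<in> q \<longleftrightarrow> {y \<in> S. x + y \<in> A} \<in> q \<and> {y \<in> S. x + y \<in> B} \<in> q" for x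
  proof -
    have e: "{y \<in> S. x + y \<in> A \<inter> B} = {y \<in> S. x + y \<in> A} \<inter> {y \<in> S. x + y \<in> B}" by auto
    show ?thesis
    proof
      assume "{y \<in> S. x + y \<in> A \<inter> B} \<in> q"
      then show "{y \<in> S. x + y \<in> A} \<in> q \<and> {y \<in> S. x + y \<in> B} \<in> q"
        by (auto elim!: ultrafilter_mono[OF assms])
    qed (unfold e, blast intro: ultrafilter_Int[OF assms])
  qed
  then show ?thesis by (auto simp: shifts_into_def)
qed

lemma shifts_into_compl:
  assumes "q \<in> beta S"
  shows "shifts_into q (S - B) = S - shifts_into q B"
proof -
  have "{y \<in> S. x + y \<in> S - B} \<in> q \<longleftrightarrow> {y \<in> S. x + y \<in> B} \<notin> q" if "x \<in> S" for x
  proof -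
    have "{y \<in> S. x + y \<in> S - B} = S - {y \<in> S. x + y \<in> B}"
      using add_closed that by auto
    then show ?thesis
      using ultrafilter_compl[OF assms, of "{y \<in> S. x + y \<in> B}"] 
        ultrafilter_not_both[OF assms] by auto
  qed
  then show ?thesis by (auto simp: shifts_into_def)
qed

lemma shifts_into_mono:
  assumes "q \<in> beta S" "A \<subseteq> B"
  shows "shifts_into q A \<subseteq> shifts_into q B"
  using shifts_into_Int[OF assms(1), of A B] assms(2) by (metis inf.absorb1 inf.cobounded2)

lemma shifts_into_subset: "shifts_into q B \<subseteq> S"
  by (auto simp: shifts_into_def)

lemma shifts_into_S: 
  assumes "q \<in> beta S" shows "shifts_into q S = S"
proof -
  have "{y \<in> S. x + y \<in> S} = S" if "x \<in> S" for x using add_closed that by auto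
  then show ?thesis using ultrafilter_whole[OF assms] by (auto simp: shifts_into_def)
qed

lemma plus_in_beta:
  assumes p: "p \<in> beta S" and q: "q \<in> beta S"
  shows "p \<oplus> q \<in> beta S"
proof -
  have e: "shifts_into q {} = {}"
    using ultrafilter_empty[OF q] by (simp add: shifts_into_def)
  have "ultrafilter_on S (p \<oplus> q)"
    unfolding ultrafilter_on_def
  proof (intro conjI ballI allI impI)
    show "p \<oplus> q \<subseteq> Pow S" by (auto simp: mem_plus)
    show "S \<in> p \<oplus> q" using shifts_into_S[OF q] ultrafilter_whole[OF p] by (simp add: mem_plus)
    show "{} \<notin> p \<oplus> q" using ultrafilter_empty[OF p] by (simp add: mem_plus e)
    show "A \<inter> B \<in> p \<oplus> q" if "A \<in> p \<oplus> q" "B \<in> p \<oplus> q" for A B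
      using that ultrafilter_Int[OF p] by (auto simp: mem_plus shifts_into_Int[OF q])
    show "B \<in> p \<oplus> q" if "A \<in> p \<oplus> q" "A \<subseteq> B \<and> B \<subseteq> S" for A B
      using ultrafilter_mono[OF p, of "shifts_into q A" "shifts_into q B"] that
        shifts_into_mono[OF q, of A B] shifts_into_subset[of q B]
      by (simp add: mem_plus)
    show "A \<in> p \<oplus> q \<or> S - A \<in> p \<oplus> q" if "A \<subseteq> S" for A
      using that ultrafilter_compl[OF p, of "shifts_into q A"] shifts_into_subset[of q A]
      by (auto simp: mem_plus shifts_into_compl[OF q])
  qed
  then show ?thesis by (simp add: beta_def)
qed

lemma plus_assoc: "p \<oplus> q \<oplus> r = p \<oplus> (q \<oplus> r)"
proof -
  have "{y \<in> S. x + y \<in> S \<and> {z \<in> S. x + y + z \<in> B} \<in> r} =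
        {y \<in> S. {z \<in> S. y + z \<in> S \<and> x + (y + z) \<in> B} \<in> r}" if "x \<in> S" for x B
  proof -
    have "{z \<in> S. y + z \<in> S \<and> x + (y + z) \<in> B} = {z \<in> S. x + y + z \<in> B}" if "y \<in> S" for y
      using that add_closed by (auto simp: add.assoc)
    then show ?thesis using that add_closed by auto
  qed
  then show ?thesis
    unfolding beta_add_def by (auto cong: conj_cong)
qed

text \<open>
  The image of a compact set under the continuous map \<open>p \<mapsto> p + q\<close>. For \<open>r\<close> in its closure, the
  conditions \<open>p \<in> K\<close> and \<open>B \<in> p + q\<close> for all \<open>B \<in> r\<close> are finitely satisfiable, and an ultrafilter \<open>p\<close> that
  satisfies all of them has \<open>p + q = r\<close>.
\<close>

lemma translate_closed:
  assumes K: "uf_closed S K" and q: "q \<in> beta S"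
  shows "uf_closed S ((\<lambda>p. p \<oplus> q) ` K)"
proof -
  let ?I = "(\<lambda>p. p \<oplus> q) ` K"
  obtain \<A> where A: "K = {p \<in> beta S. \<A> \<subseteq> p}" using K unfolding uf_closed_def by blast
  have "r \<in> ?I" if r: "r \<in> beta S" "\<Inter>?I \<subseteq> r" for r
  proof -
    have "\<exists>p\<in>beta S. \<A> \<union> shifts_into q ` r \<subseteq> p"
    proof (rule ultrafilter_compactness)
      fix F assume F: "finite F" "F \<subseteq> \<A> \<union> shifts_into q ` r"
      then have "finite (F - \<A>)" "F - \<A> \<subseteq> shifts_into q ` r" by auto
      then obtain G where G: "G \<subseteq> r" "finite G" "F - \<A> = shifts_into q ` G"
        by (meson finite_subset_image)
      have B: "S \<inter> \<Inter>G \<in> r" by (rule ultrafilter_Inter[OF r(1) G(2,1)])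
      \<comment> \<open>Otherwise the complement belongs to every point of the image and therefore to its limit point r.\<close>
      have "\<exists>p\<in>K. S \<inter> \<Inter>G \<in> p \<oplus> q"
      proof (rule ccontr)
        assume "\<not> ?thesis"
        then have "S - (S \<inter> \<Inter>G) \<in> p \<oplus> q" if "p \<in> K" for p
          using that A q by (intro ultrafilter_compl plus_in_beta) auto
        then have "S - (S \<inter> \<Inter>G) \<in> r" using r(2) by blast
        then show False using ultrafilter_not_both[OF r(1) B] by simp
      qed
      then obtain p where p: "p \<in> K" "shifts_into q (S \<inter> \<Inter>G) \<in> p" by (auto simp: mem_plus)
      then have pA: "p \<in> beta S" "\<A> \<subseteq> p" by (simp_all add: A)
      have "shifts_into q C \<in> p" if "C \<in> G" for C
      proof (rule ultrafilter_mono[OF pA(1) p(2)])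
        show "shifts_into q (S \<inter> \<Inter>G) \<subseteq> shifts_into q C"
          using that by (intro shifts_into_mono[OF q]) auto
      qed (fact shifts_into_subset)
      then have "F - \<A> \<subseteq> p" unfolding G(3) by auto
      then have "F \<subseteq> p" using pA(2) by auto
      then show "\<exists>p\<in>beta S. F \<subseteq> p" using pA(1) by (rule bexI)
    qed
    then obtain p where p: "p \<in> beta S" "\<A> \<subseteq> p" "shifts_into q ` r \<subseteq> p" by auto
    have "r \<subseteq> p \<oplus> q" using p(3) ultrafilter_subset[OF r(1)] by (auto simp: mem_plus)
    then have "r = p \<oplus> q" using ultrafilter_eqI[OF r(1) plus_in_beta[OF p(1) q]] by simp
    then show ?thesis using p(1,2) by (simp add: A)
  qed
  moreover have "r \<in> beta S \<and> \<Inter>?I \<subseteq> r" if r: "r \<in> ?I" for r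
  proof -
    obtain p where "p \<in> K" "r = p \<oplus> q" using r by auto
    then have "r \<in> beta S" using plus_in_beta[OF _ q] by (simp add: A)
    then show ?thesis using Inter_lower[OF r] by (rule conjI)
  qed
  ultimately have "r \<in> ?I \<longleftrightarrow> r \<in> beta S \<and> \<Inter>?I \<subseteq> r" for r by metis
  then have "?I = {r \<in> beta S. \<Inter>?I \<subseteq> r}" by (intro set_eqI) (simp only: mem_Collect_eq)
  then show ?thesis unfolding uf_closed_def by blast
qed

lemma translate_fibre_closed:
  assumes K: "uf_closed S K" and q: "q \<in> beta S" and r: "r \<in> beta S"
  shows "uf_closed S {p \<in> K. p \<oplus> q = r}"
proof -
  obtain \<A> where A: "K = {p \<in> beta S. \<A> \<subseteq> p}" using K unfolding uf_closed_def by blast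
  have "p \<oplus> q = r \<longleftrightarrow> shifts_into q ` r \<subseteq> p" if p: "p \<in> beta S" for p
  proof
    assume "shifts_into q ` r \<subseteq> p"
    then have "r \<subseteq> p \<oplus> q" using ultrafilter_subset[OF r] by (auto simp: mem_plus)
    then show "p \<oplus> q = r" using ultrafilter_eqI[OF r plus_in_beta[OF p q]] by simp
  qed (auto simp: mem_plus)
  then have "{p \<in> K. p \<oplus> q = r} = {p \<in> beta S. \<A> \<union> shifts_into q ` r \<subseteq> p}"
    using A by auto
  then show ?thesis unfolding uf_closed_def by blast
qed

lemma zero_plus_beta: "p \<in> zero_plus S \<Longrightarrow> p \<in> beta S"
  by (simp add: zero_plus_def)

lemma zero_plus_interval: "p \<in> zero_plus S \<Longrightarrow> 0 < \<epsilon> \<Longrightarrow> {x \<in> S. x < \<epsilon>} \<in> p"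
proof -
  assume "p \<in> zero_plus S" "0 < \<epsilon>"
  then have "{0<..<\<epsilon>} \<inter> S \<in> p" by (simp add: zero_plus_def)
  moreover have "{0<..<\<epsilon>} \<inter> S = {x \<in> S. x < \<epsilon>}" using pos by auto
  ultimately show ?thesis by simp
qed

lemma zero_plus_add:
  assumes "p \<in> zero_plus S" "q \<in> zero_plus S" shows "p \<oplus> q \<in> zero_plus S"
proof -
  have "{0<..<\<epsilon>} \<inter> S \<in> p \<oplus> q" if "0 < \<epsilon>" for \<epsilon>
  proof -
    let ?H = "{x \<in> S. x < \<epsilon> / 2}"
    have H: "?H \<in> p" "?H \<in> q" using assms zero_plus_interval[of _ "\<epsilon> / 2"] that by auto
    have "{y \<in> S. x + y \<in> {0<..<\<epsilon>} \<inter> S} \<in> q" if x: "x \<in> ?H" for x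
      using x pos add_closed
      by (intro ultrafilter_mono[OF zero_plus_beta[OF assms(2)] H(2)]) (force intro: add_pos_pos)+
    then have "?H \<subseteq> shifts_into q ({0<..<\<epsilon>} \<inter> S)" by (auto simp: shifts_into_def)
    then have "shifts_into q ({0<..<\<epsilon>} \<inter> S) \<in> p"
      using ultrafilter_mono[OF zero_plus_beta[OF assms(1)] H(1)] shifts_into_subset by blast
    then show ?thesis by (simp add: mem_plus)
  qed
  moreover have "p \<oplus> q \<in> beta S" using assms by (simp add: zero_plus_beta plus_in_beta)
  ultimately show ?thesis unfolding zero_plus_def by simp
qed

lemma zero_plus_closed: "uf_closed S (zero_plus S)"
proof -
  have "zero_plus S = {p \<in> beta S. (\<lambda>\<epsilon>. {0<..<\<epsilon>} \<inter> S) ` {0<..} \<subseteq> p}" by (auto simp: zero_plus_def)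
  then show ?thesis unfolding uf_closed_def by blast
qed

lemma zero_plus_nonempty: "zero_plus S \<noteq> {}"
proof -
  have "fip S ((\<lambda>\<epsilon>. {0<..<\<epsilon>} \<inter> S) ` {0<..})"
    unfolding fip_def
  proof (intro conjI allI impI)
    fix F assume F: "finite F \<and> F \<subseteq> (\<lambda>\<epsilon>::real. {0<..<\<epsilon>} \<inter> S) ` {0<..}"
    then obtain E where E: "E \<subseteq> {0<..}" "finite E" "F = (\<lambda>\<epsilon>. {0<..<\<epsilon>} \<inter> S) ` E"
      by (meson finite_subset_image)
    then have "0 < Min (insert 1 E)" by auto
    then obtain x where x: "x \<in> S" "x < Min (insert 1 E)"
      using small_elements by metis
    then have "x < \<epsilon>" if "\<epsilon> \<in> E" for \<epsilon> using E(2) that by simp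
    then have "x \<in> S \<inter> \<Inter>F" using x(1) pos by (simp add: E(3))
    then show "S \<inter> \<Inter>F \<noteq> {}" by auto
  qed auto
  then obtain p where "p \<in> beta S" "(\<lambda>\<epsilon>. {0<..<\<epsilon>} \<inter> S) ` {0<..} \<subseteq> p"
    using fip_extends_to_ultrafilter by metis
  then have "p \<in> zero_plus S" by (auto simp: zero_plus_def)
  then show ?thesis by auto
qed

text \<open>
  The theorem of Ellis and Numakura. In a minimal closed subsemigroup \<open>K\<close> fix \<open>p\<close>. Then \<open>K + p\<close> is
  a closed subsemigroup, so it is all of \<open>K\<close> and contains \<open>p\<close>; hence \<open>{q \<in> K. q + p = p}\<close> is a nonempty
  closed subsemigroup, so it is all of \<open>K\<close> as well and contains \<open>p\<close>.
\<close>

lemma closed_subsemigroup_idempotent: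
  assumes L: "uf_closed S L" "L \<noteq> {}" "\<And>p q. p \<in> L \<Longrightarrow> q \<in> L \<Longrightarrow> p \<oplus> q \<in> L"
  shows "\<exists>p\<in>L. p \<oplus> p = p"
proof -
  define \<F> where "\<F> = {K. uf_closed S K \<and> K \<noteq> {} \<and> K \<subseteq> L \<and> (\<forall>p\<in>K. \<forall>q\<in>K. p \<oplus> q \<in> K)}"
  have "\<exists>K\<in>\<F>. \<forall>H\<in>\<F>. H \<subseteq> K \<longrightarrow> H = K"
  proof (rule minimal_closed_set)
    show "\<F> \<noteq> {}" using L by (auto simp: \<F>_def)
    show "uf_closed S K \<and> K \<noteq> {}" if "K \<in> \<F>" for K using that by (simp add: \<F>_def)
    show "\<Inter>\<C> \<in> \<F>" if "\<C> \<noteq> {}" "\<C> \<subseteq> \<F>" "\<Inter>\<C> \<noteq> {}" for \<C>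
      using that uf_closed_Inter[of \<C> S] unfolding \<F>_def by fast
  qed
  then obtain K where K: "K \<in> \<F>" and min: "\<And>H. H \<in> \<F> \<Longrightarrow> H \<subseteq> K \<Longrightarrow> H = K" by blast
  then obtain p where p: "p \<in> K" by (auto simp: \<F>_def)
  have Kcl: "uf_closed S K" and KL: "K \<subseteq> L" and Kadd: "\<And>p q. p \<in> K \<Longrightarrow> q \<in> K \<Longrightarrow> p \<oplus> q \<in> K"
    using K by (auto simp: \<F>_def)
  have pb: "p \<in> beta S" using Kcl p unfolding uf_closed_def by blast
  have "(\<lambda>q. q \<oplus> p) ` K = K"
  proof (rule min)
    have "q \<oplus> p \<oplus> (r \<oplus> p) \<in> (\<lambda>q. q \<oplus> p) ` K" if "q \<in> K" "r \<in> K" for q r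
      using Kadd[OF Kadd[OF that(1) p] that(2)] plus_assoc[of "q \<oplus> p" r p] by auto
    then show "(\<lambda>q. q \<oplus> p) ` K \<in> \<F>"
      using translate_closed[OF Kcl pb] p Kadd KL by (auto simp: \<F>_def)
    show "(\<lambda>q. q \<oplus> p) ` K \<subseteq> K" using Kadd p by auto
  qed
  with p have "p \<in> (\<lambda>q. q \<oplus> p) ` K" by simp
  then have ne: "{q \<in> K. q \<oplus> p = p} \<noteq> {}" by auto
  have "{q \<in> K. q \<oplus> p = p} = K"
  proof (rule min)
    show "{q \<in> K. q \<oplus> p = p} \<in> \<F>"
      using translate_fibre_closed[OF Kcl pb pb] ne Kadd KL by (auto simp: \<F>_def plus_assoc)
  qed auto
  then show ?thesis using p KL by auto
qed

definition left_ideal :: "real set set set \<Rightarrow> bool" where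
  "left_ideal L \<longleftrightarrow> L \<noteq> {} \<and> L \<subseteq> zero_plus S \<and> (\<forall>p\<in>zero_plus S. \<forall>q\<in>L. p \<oplus> q \<in> L)"

text \<open>
  A left ideal \<open>J\<close> contains the closed left ideal \<open>0\<^sup>+(S) + q\<close> for each \<open>q \<in> J\<close>. A minimal closed left
  ideal is therefore minimal among all left ideals.
\<close>

lemma minimal_left_ideal_exists:
  "\<exists>L. uf_closed S L \<and> left_ideal L \<and> (\<forall>J. left_ideal J \<and> J \<subseteq> L \<longrightarrow> J = L)"
proof -
  define \<F> where "\<F> = {K. uf_closed S K \<and> left_ideal K}"
  have "\<exists>K\<in>\<F>. \<forall>H\<in>\<F>. H \<subseteq> K \<longrightarrow> H = K"
  proof (rule minimal_closed_set)
    show "\<F> \<noteq> {}" using zero_plus_closed zero_plus_nonempty zero_plus_add by (auto simp: \<F>_def left_ideal_def)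
    show "uf_closed S K \<and> K \<noteq> {}" if "K \<in> \<F>" for K
      using that by (simp add: \<F>_def left_ideal_def)
    show "\<Inter>\<C> \<in> \<F>" if "\<C> \<noteq> {}" "\<C> \<subseteq> \<F>" "\<Inter>\<C> \<noteq> {}" for \<C>
      using that uf_closed_Inter[of \<C> S] unfolding \<F>_def left_ideal_def by fast
  qed
  then obtain L where L: "L \<in> \<F>" and min: "\<And>H. H \<in> \<F> \<Longrightarrow> H \<subseteq> L \<Longrightarrow> H = L" by blast
  have "J = L" if J: "left_ideal J" "J \<subseteq> L" for J
  proof -
    obtain q where q: "q \<in> J" using J(1) by (auto simp: left_ideal_def)
    then have qZ: "q \<in> zero_plus S" using J(1) by (auto simp: left_ideal_def)
    have "(\<lambda>p. p \<oplus> q) ` (zero_plus S) \<in> \<F>"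
      using translate_closed[OF zero_plus_closed zero_plus_beta[OF qZ]] zero_plus_nonempty zero_plus_add qZ
      by (auto simp: \<F>_def left_ideal_def plus_assoc[symmetric])
    moreover have sub: "(\<lambda>p. p \<oplus> q) ` (zero_plus S) \<subseteq> J" using J(1) q by (auto simp: left_ideal_def)
    ultimately show ?thesis using min[of "(\<lambda>p. p \<oplus> q) ` (zero_plus S)"] J(2) by auto
  qed
  then show ?thesis using L by (auto simp: \<F>_def)
qed

text \<open>
  For a minimal left ideal \<open>L\<close> the set \<open>L + 0\<^sup>+(S)\<close> is a two-sided ideal. It is the smallest one: any
  two-sided ideal \<open>J\<close> meets \<open>L\<close> in a left ideal, so \<open>J\<close> contains \<open>L\<close> by minimality, and then \<open>L + 0\<^sup>+(S)\<close>.
  An idempotent \<open>p\<close> of \<open>L\<close> lies in this ideal because \<open>p = p + p\<close>.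
\<close>

theorem minimal_idempotent_exists: "\<exists>p\<in>zero_plus S. minimal_idempotent S p"
proof -
  from minimal_left_ideal_exists
  obtain L where Lmin: "uf_closed S L \<and> left_ideal L \<and> (\<forall>J. left_ideal J \<and> J \<subseteq> L \<longrightarrow> J = L)"
    by (rule exE)
  have L: "uf_closed S L" "left_ideal L" using Lmin by simp_all
  have min: "J = L" if "left_ideal J" "J \<subseteq> L" for J using Lmin that by simp
  have ne: "L \<noteq> {}" and LZ: "\<And>q. q \<in> L \<Longrightarrow> q \<in> zero_plus S"
    and left: "\<And>p q. p \<in> zero_plus S \<Longrightarrow> q \<in> L \<Longrightarrow> p \<oplus> q \<in> L"
    using L(2) by (auto simp: left_ideal_def)
  define I where "I = {p \<oplus> q | p q. p \<in> L \<and> q \<in> zero_plus S}"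
  have I: "p \<oplus> q \<in> I" if "p \<in> L" "q \<in> zero_plus S" for p q using that by (auto simp: I_def)
  have "smallest_ideal S = I"
    unfolding smallest_ideal_def
  proof (rule Least_equality)
    show "two_sided_ideal S I"
      unfolding two_sided_ideal_def
    proof (intro conjI ballI)
      show "I \<noteq> {}" using ne LZ by (auto simp: I_def)
      show "I \<subseteq> zero_plus S" using LZ zero_plus_add by (auto simp: I_def)
      fix p q assume p: "p \<in> zero_plus S" and "q \<in> I"
      then obtain l s where ls: "q = l \<oplus> s" "l \<in> L" "s \<in> zero_plus S" by (auto simp: I_def)
      show "p \<oplus> q \<in> I" using I[OF left[OF p ls(2)] ls(3)] by (simp add: ls(1) plus_assoc)
      show "q \<oplus> p \<in> I" using I[OF ls(2) zero_plus_add[OF ls(3) p]] by (simp add: ls(1) plus_assoc)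
    qed
    fix J assume "two_sided_ideal S J"
    then have J: "J \<noteq> {}" "\<And>q. q \<in> J \<Longrightarrow> q \<in> zero_plus S" "\<And>p q. p \<in> zero_plus S \<Longrightarrow> q \<in> J \<Longrightarrow> p \<oplus> q \<in> J"
      "\<And>p q. p \<in> zero_plus S \<Longrightarrow> q \<in> J \<Longrightarrow> q \<oplus> p \<in> J"
      by (auto simp: two_sided_ideal_def)
    obtain i l where "i \<in> J" "l \<in> L" using J(1) ne by auto
    then have "i \<oplus> l \<in> J \<inter> L" using J(2,4) LZ left by simp
    then have "J \<inter> L \<noteq> {}" by auto
    then have "left_ideal (J \<inter> L)" using J(3) LZ left by (auto simp: left_ideal_def)
    then have "J \<inter> L = L" by (rule min) simp
    then show "I \<le> J" using J(4) by (auto simp: I_def)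
  qed
  moreover obtain p where "p \<in> L" "p \<oplus> p = p"
    using closed_subsemigroup_idempotent[OF L(1) ne left[OF LZ]] by auto
  ultimately show ?thesis
    using LZ[of p] I[of p p] by (auto simp: minimal_idempotent_def)
qed

section \<open>Milliken-Taylor systems near zero\<close>

lemma idempotent_return:
  assumes p: "p \<in> beta S" "p \<oplus> p = p" and A: "A \<in> p"
  shows "{x \<in> A. {y \<in> S. x + y \<in> A} \<in> p} \<in> p"
proof -
  have "shifts_into p A \<in> p" using A p(2) mem_plus[of A p p] by simp
  then have "A \<inter> shifts_into p A \<in> p" by (rule ultrafilter_Int[OF p(1) A])
  moreover have "A \<inter> shifts_into p A = {x \<in> A. {y \<in> S. x + y \<in> A} \<in> p}"
    using ultrafilter_subset[OF p(1) A] by (auto simp: shifts_into_def)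
  ultimately show ?thesis by simp
qed

text \<open>
  The Galvin-Glazer construction. It maintains a set \<open>B\<^sub>n \<in> p\<close>, the next term \<open>x\<^sub>n\<close>, and the finite set
  \<open>W\<^sub>n\<close> of all sums of the terms up to \<open>x\<^sub>n\<close>. Idempotency of \<open>p\<close> allows \<open>x\<^sub>n\<close> to be chosen in \<open>B\<^sub>n\<close> with
  \<open>-x\<^sub>n + B\<^sub>n \<in> p\<close>, so that \<open>B\<^sub>n\<^sub>+\<^sub>1\<close> can be taken inside \<open>B\<^sub>n \<inter> (-x\<^sub>n + B\<^sub>n)\<close>, and then all sums of later terms
  stay in \<open>B\<^sub>n\<^sub>+\<^sub>1\<close>. Intersecting moreover with \<open>Q w\<close> for the finitely many \<open>w \<in> W\<^sub>n\<close> controls the pairs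
  of sums over consecutive blocks.
\<close>

lemma milliken_taylor_sequence:
  assumes p: "p \<in> beta S" "p \<oplus> p = p" and A: "A \<in> p" and Q: "\<And>u. u \<in> A \<Longrightarrow> Q u \<in> p"
  shows "\<exists>x :: nat \<Rightarrow> real. (\<forall>F. finite F \<and> F \<noteq> {} \<longrightarrow> sum x F \<in> A) \<and>
           (\<forall>F G. block_pair F G \<longrightarrow> sum x G \<in> Q (sum x F))"
proof -
  \<comment> \<open>Outside A the condition is void, so that R can be used before the sums are known to lie in A.\<close>
  define R where "R u = (if u \<in> A then Q u else S)" for u
  have R: "R u \<in> p" for u using Q ultrafilter_whole[OF p(1)] by (simp add: R_def)
  define good where "good s \<longleftrightarrow> (case s of (x, B, W) \<Rightarrow>
    B \<in> p \<and> B \<subseteq> A \<and> x \<in> B \<and> {y \<in> S. x + y \<in> B} \<in> p \<and> finite W \<and> x \<in> W)"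
    for s :: "real \<times> real set \<times> real set"
  define step where "step s t \<longleftrightarrow> (case s of (x, B, W) \<Rightarrow> case t of (x', B', W') \<Rightarrow>
    B' \<subseteq> B \<and> (\<forall>y\<in>B'. x + y \<in> B) \<and> (\<forall>w\<in>W. B' \<subseteq> R w) \<and> W \<union> (+) x' ` W \<subseteq> W')"
    for s t :: "real \<times> real set \<times> real set"
  have pick: "\<exists>x\<in>B. {y \<in> S. x + y \<in> B} \<in> p" if "B \<in> p" for B
    using ultrafilter_nonempty[OF p(1) idempotent_return[OF p that]] by auto
  have "\<exists>f. \<forall>n::nat. good (f n) \<and> step (f n) (f (Suc n))"
  proof (rule dependent_nat_choice)
    obtain x where "x \<in> A" "{y \<in> S. x + y \<in> A} \<in> p" using pick[OF A] by auto
    then have "good (x, A, {x})" using A by (simp add: good_def)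
    then show "\<exists>s. good s" by (rule exI)
  next
    fix s :: "real \<times> real set \<times> real set" and n :: nat
    assume "good s"
    then obtain x B W where s: "s = (x, B, W)" and B: "B \<in> p" "B \<subseteq> A" "x \<in> B"
      "{y \<in> S. x + y \<in> B} \<in> p" and W: "finite W" "x \<in> W"
      by (cases s) (auto simp: good_def)
    define B' where "B' = B \<inter> ({y \<in> S. x + y \<in> B} \<inter> (S \<inter> \<Inter>(R ` W)))"
    have RW: "S \<inter> \<Inter>(R ` W) \<in> p" using W(1) R by (intro ultrafilter_Inter[OF p(1)]) auto
    have B': "B' \<in> p" unfolding B'_def by (rule ultrafilter_Int[OF p(1) B(1) ultrafilter_Int[OF p(1) B(4) RW]])
    obtain x' where x': "x' \<in> B'" "{y \<in> S. x' + y \<in> B'} \<in> p" using pick[OF B'] by auto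
    define W' where "W' = insert x' (W \<union> (+) x' ` W)"
    have "B' \<subseteq> A" using B(2) by (auto simp: B'_def)
    then have "good (x', B', W')" using B' x' W by (simp add: good_def W'_def)
    moreover have "step s (x', B', W')" by (auto simp: s step_def B'_def W'_def)
    ultimately show "\<exists>t. good t \<and> step s t" by auto
  qed
  then obtain f where f: "\<And>n::nat. good (f n)" "\<And>n. step (f n) (f (Suc n))" by metis
  define x where "x n = fst (f n)" for n
  define B where "B n = fst (snd (f n))" for n
  define W where "W n = snd (snd (f n))" for n
  have fn: "f n = (x n, B n, W n)" for n by (simp add: x_def B_def W_def)
  have BA: "B n \<subseteq> A" and xB: "x n \<in> B n" and xW: "x n \<in> W n" for n
    using f(1)[of n] by (simp_all add: fn good_def)
  have BS: "B (Suc n) \<subseteq> B n" and shift: "y \<in> B (Suc n) \<Longrightarrow> x n + y \<in> B n"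
    and BR: "w \<in> W n \<Longrightarrow> B (Suc n) \<subseteq> R w" 
    and WS: "W n \<subseteq> W (Suc n)" and Wx: "w \<in> W n \<Longrightarrow> x (Suc n) + w \<in> W (Suc n)" for n y w
    using f(2)[of n] by (auto simp: fn step_def)
  have Bmono: "B n \<subseteq> B m" if "m \<le> n" for m n
    using BS by (intro lift_Suc_antimono_le[OF _ that]) 
  have tails: "sum x F \<in> B m" if "finite F" "F \<noteq> {}" "\<forall>i\<in>F. m \<le> i" for F m
    using that
  proof (induction "card F" arbitrary: F m rule: less_induct)
    case less
    define k where "k = Min F"
    have k: "k \<in> F" using less.prems by (simp add: k_def)
    have "m \<le> k" using less.prems k by auto
    have split: "sum x F = x k + sum x (F - {k})" using less.prems(1) k by (simp add: sum.remove)
    have "sum x F \<in> B k"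
    proof (cases "F - {k} = {}")
      case True
      then show ?thesis using split xB[of k] by (simp only: True) simp
    next
      case False
      have "\<forall>i\<in>F - {k}. Suc k \<le> i" using less.prems(1) by (auto simp: k_def Suc_le_eq order_le_neq_trans)
      then have "sum x (F - {k}) \<in> B (Suc k)"
        using False less.prems(1) card_Diff1_less[OF less.prems(1) k] by (intro less.hyps) simp_all
      then show ?thesis using split shift by simp
    qed
    then show ?case using Bmono[OF \<open>m \<le> k\<close>] by auto
  qed
  have heads: "sum x F \<in> W n" if "finite F" "F \<noteq> {}" "\<forall>i\<in>F. i \<le> n" for F n
    using that
  proof (induction n arbitrary: F)
    case 0
    then have "F = {0}" by auto
    then show ?case using xW by simp
  next
    case (Suc n)
    show ?case
    proof (cases "Suc n \<in> F")
      case False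
      then have "\<forall>i\<in>F. i \<le> n" using Suc.prems(3) by (metis le_SucE)
      then show ?thesis using Suc WS by blast
    next
      case True
      have split: "sum x F = x (Suc n) + sum x (F - {Suc n})"
        using Suc.prems(1) True by (simp add: sum.remove)
      show ?thesis
      proof (cases "F - {Suc n} = {}")
        case True
        then show ?thesis using split xW[of "Suc n"] by (simp only: True) simp
      next
        case False
        have "\<forall>i\<in>F - {Suc n}. i \<le> n" using Suc.prems(3) by (metis DiffD1 DiffD2 insertCI le_SucE)
        then have "sum x (F - {Suc n}) \<in> W n" using Suc False by simp
        then show ?thesis using split Wx by simp
      qed
    qed
  qed
  have "sum x F \<in> A" if "finite F" "F \<noteq> {}" for F
    using tails[OF that, of 0] BA[of 0] by auto
  moreover have "sum x G \<in> Q (sum x F)" if FG: "block_pair F G" for F G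
  proof -
    have F: "finite F" "F \<noteq> {}" and G: "finite G" "G \<noteq> {}" and less: "\<And>i j. i \<in> F \<Longrightarrow> j \<in> G \<Longrightarrow> i < j"
      using FG by (auto simp: block_pair_def)
    have "sum x F \<in> W (Max F)" using F by (intro heads) auto
    moreover have "sum x G \<in> B (Suc (Max F))"
      using F G less by (intro tails) (auto simp: Suc_le_eq)
    ultimately have "sum x G \<in> R (sum x F)" using BR by blast
    then show ?thesis using tails[OF F, of 0] BA[of 0] by (auto simp: R_def)
  qed
  ultimately show ?thesis by blast
qed

lemma idempotent_exists: "\<exists>p\<in>zero_plus S. p \<oplus> p = p"
  using minimal_idempotent_exists unfolding minimal_idempotent_def by metis

lemma finite_sums_near_zero:
  assumes "finite (\<chi> ` S)" "\<epsilon> > 0"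
  shows "\<exists>x c. (\<forall>j. x j \<in> S) \<and> (\<forall>F. finite F \<and> F \<noteq> {} \<longrightarrow>
     sum x F \<in> S \<inter> {0<..<\<epsilon>} \<and> \<chi> (sum (x :: nat \<Rightarrow> real) F) = c)"
proof -
  obtain p where p: "p \<in> zero_plus S" "p \<oplus> p = p" using idempotent_exists by auto
  have pb: "p \<in> beta S" using p(1) by (rule zero_plus_beta)
  obtain c where "{x \<in> S. \<chi> x = c} \<in> p" using ultrafilter_finite_coloring[OF pb assms(1)] by auto
  then have A: "{x \<in> S. x < \<epsilon>} \<inter> {x \<in> S. \<chi> x = c} \<in> p"
    by (intro ultrafilter_Int[OF pb] zero_plus_interval[OF p(1) assms(2)])
  obtain x :: "nat \<Rightarrow> real" where x: "\<And>F. finite F \<and> F \<noteq> {} \<Longrightarrow> sum x F \<in> {x \<in> S. x < \<epsilon>} \<inter> {x \<in> S. \<chi> x = c}"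
    using milliken_taylor_sequence[OF pb p(2) A, of "\<lambda>_. S"] ultrafilter_whole[OF pb] by metis
  have "x j \<in> S" for j using x[of "{j}"] by simp
  then show ?thesis using x pos by (intro exI[of _ x] exI[of _ c]) auto
qed

text \<open>
  For each \<open>u\<close> the color of \<open>u + 2 v\<close> takes one value \<open>d u\<close> for \<open>p\<close>-almost all \<open>v\<close>, and \<open>d\<close> in turn takes
  one value for \<open>p\<close>-almost all \<open>u\<close>.
\<close>

lemma milliken_taylor_near_zero:
  assumes fin: "finite (\<chi> ` S)" and "\<epsilon> > 0"
  shows "\<exists>x c. (\<forall>j. x j \<in> S) \<and> (\<forall>F G. block_pair F G \<longrightarrow>
     sum x F + 2 * sum x G \<in> S \<inter> {0<..<\<epsilon>} \<and> \<chi> (sum (x :: nat \<Rightarrow> real) F + 2 * sum x G) = c)"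
proof -
  obtain p where p: "p \<in> zero_plus S" "p \<oplus> p = p" using idempotent_exists by auto
  have pb: "p \<in> beta S" using p(1) by (rule zero_plus_beta)
  have tri: "u + 2 * v \<in> S" if "u \<in> S" "v \<in> S" for u v
    using add_closed[OF add_closed[OF that] that(2)] by (simp add: algebra_simps)
  have "\<exists>d. {v \<in> S. \<chi> (u + 2 * v) = d} \<in> p" if "u \<in> S" for u
    using that tri by (intro ultrafilter_finite_coloring[OF pb] finite_subset[OF _ fin]) auto
  then obtain d where d: "\<And>u. u \<in> S \<Longrightarrow> {v \<in> S. \<chi> (u + 2 * v) = d u} \<in> p" by metis
  have "d u \<in> \<chi> ` S" if u: "u \<in> S" for u
  proof -
    obtain v where "v \<in> S" "\<chi> (u + 2 * v) = d u"
      using ultrafilter_nonempty[OF pb d[OF u]] by auto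
    then show ?thesis using tri[OF u] by (metis imageI)
  qed
  then have "finite (d ` S)" by (intro finite_subset[OF _ fin]) auto
  then obtain c where c: "{u \<in> S. d u = c} \<in> p" using ultrafilter_finite_coloring[OF pb] by metis
  have small: "{x \<in> S. x < \<epsilon> / 3} \<in> p" using assms(2) by (intro zero_plus_interval[OF p(1)]) auto
  define A where "A = {x \<in> S. x < \<epsilon> / 3} \<inter> {u \<in> S. d u = c}"
  have A: "A \<in> p" unfolding A_def by (rule ultrafilter_Int[OF pb small c])
  obtain x :: "nat \<Rightarrow> real" where x: "\<And>F. finite F \<and> F \<noteq> {} \<Longrightarrow> sum x F \<in> A"
    and xx: "\<And>F G. block_pair F G \<Longrightarrow> sum x G \<in> {v \<in> S. \<chi> (sum x F + 2 * v) = d (sum x F)}"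
    using milliken_taylor_sequence[OF pb p(2) A, of "\<lambda>u. {v \<in> S. \<chi> (u + 2 * v) = d u}"] d
    unfolding A_def by (metis (no_types, lifting) IntD1 mem_Collect_eq)
  have xS: "x j \<in> S" for j using x[of "{j}"] by (simp add: A_def)
  have "sum x F + 2 * sum x G \<in> S \<inter> {0<..<\<epsilon>} \<and> \<chi> (sum x F + 2 * sum x G) = c"
    if FG: "block_pair F G" for F G
  proof -
    have "sum x F \<in> A" "sum x G \<in> A" using x FG by (auto simp: block_pair_def)
    then have "sum x F \<in> S" "sum x G \<in> S" "sum x F < \<epsilon> / 3" "sum x G < \<epsilon> / 3" "d (sum x F) = c"
      by (auto simp: A_def)
    then show ?thesis using tri[of "sum x F" "sum x G"] pos xx[OF FG] by auto
  qed
  then show ?thesis using xS by blast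
qed

end

section \<open>The rows of the matrices\<close>

lemma sorted_list_of_set_append:
  fixes A B :: "'a::linorder set"
  assumes "finite A" "finite B" "\<And>a b. a \<in> A \<Longrightarrow> b \<in> B \<Longrightarrow> a < b"
  shows "sorted_list_of_set (A \<union> B) = sorted_list_of_set A @ sorted_list_of_set B"
proof -
  have disj: "A \<inter> B = {}" using assms(3) by blast
  show ?thesis
    using assms disj by (intro sorted_distinct_set_unique) (auto simp: sorted_append dest: less_imp_le)
qed

lemma finite_sums_row:
  assumes M: "finite_sums_matrix M"
  shows "\<exists>F. finite F \<and> F \<noteq> {} \<and> (\<forall>x. mat_apply M x i = sum x F)"
proof -
  have "M i \<in> range M" by simp
  then have r: "range (M i) \<subseteq> {0, 1}" and fin: "finite {n. M i n \<noteq> 0}" and ne: "\<exists>n. M i n \<noteq> 0"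
    using M unfolding finite_sums_matrix_def finitely_supported_def by simp_all
  have "M i j = 1" if "M i j \<noteq> 0" for j using r that by auto
  then have "mat_apply M x i = sum x {n. M i n \<noteq> 0}" for x
    unfolding mat_apply_def by (intro sum.cong) simp_all
  then show ?thesis using fin ne by blast
qed

lemma finite_sums_row_ex:
  assumes M: "finite_sums_matrix M" and F: "finite F" "F \<noteq> {}"
  shows "\<exists>i. \<forall>x. mat_apply M x i = sum x F"
proof -
  define a :: "nat \<Rightarrow> rat" where "a n = (if n \<in> F then 1 else 0)" for n
  have supp: "{n. a n \<noteq> 0} = F" by (auto simp: a_def)
  then have "a \<in> range M"
    using M F unfolding finite_sums_matrix_def finitely_supported_def by (auto simp: a_def)
  then obtain i where "M i = a" by auto
  then have "mat_apply M x i = sum x F" for x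
    unfolding mat_apply_def using supp by (auto simp: a_def)
  then show ?thesis by blast
qed

text \<open>
  The list of nonzero entries has adjacent duplicates removed to \<open>[1, 2]\<close>, so it consists of ones
  followed by twos; the places before and after the switch form the two blocks.
\<close>

lemma milliken_taylor_row:
  assumes N: "milliken_taylor_matrix [1, 2] N"
  shows "\<exists>F G. block_pair F G \<and> (\<forall>x. mat_apply N x i = sum x F + 2 * sum x G)"
proof -
  define a where "a = N i"
  define xs where "xs = sorted_list_of_set {n. a n \<noteq> 0}"
  have "a \<in> range N" by (simp add: a_def)
  then have fin: "finite {n. a n \<noteq> 0}" and c: "remdups_adj (map a xs) = [1, 2]"
    using N unfolding milliken_taylor_matrix_def finitely_supported_def compressed_form_def xs_def
    by simp_all
  have set_xs: "set xs = {n. a n \<noteq> 0}" using fin by (simp add: xs_def)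
  have sorted: "sorted_wrt (<) xs" by (simp add: xs_def)
  define ys zs where "ys = takeWhile (\<lambda>n. a n = 1) xs" and "zs = dropWhile (\<lambda>n. a n = 1) xs"
  have xs: "xs = ys @ zs" by (simp add: ys_def zs_def)
  have y1: "a n = 1" if "n \<in> set ys" for n using that by (auto simp: ys_def dest: set_takeWhileD)
  obtain k ks where xsk: "xs = k # ks" using c by (cases xs) auto
  then have k1: "a k = 1" using c by (simp add: remdups_adj_Cons')
  have "remdups_adj (dropWhile (\<lambda>b. b = 1) (map a ks)) = [2]"
    using c k1 by (simp add: xsk remdups_adj_Cons')
  moreover have "dropWhile (\<lambda>b. b = 1) (map a ks) = map a zs"
    by (simp add: zs_def xsk k1 dropWhile_map comp_def)
  ultimately have zc: "remdups_adj (map a zs) = [2]" by simp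
  then have "set (map a zs) = {2}" by (metis remdups_adj_set list.set(1,2))
  then have z2: "a n = 2" if "n \<in> set zs" for n using that by auto
  have ne: "set ys \<noteq> {}" "set zs \<noteq> {}" using k1 zc by (auto simp: ys_def xsk)
  have pair: "block_pair (set ys) (set zs)"
    using ne sorted by (auto simp: block_pair_def xs sorted_wrt_append)
  have "mat_apply N x i = sum x (set ys) + 2 * sum x (set zs)" for x
  proof -
    have "mat_apply N x i = (\<Sum>j\<in>set ys \<union> set zs. of_rat (a j) * x j)"
      using set_xs by (simp add: mat_apply_def a_def xs)
    also have "\<dots> = (\<Sum>j\<in>set ys. of_rat (a j) * x j) + (\<Sum>j\<in>set zs. of_rat (a j) * x j)"
      using pair by (intro sum.union_disjoint) (auto simp: block_pair_def)
    also have "\<dots> = sum x (set ys) + (\<Sum>j\<in>set zs. 2 * x j)"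
      using y1 z2 by simp
    finally show ?thesis by (simp add: sum_distrib_left)
  qed
  then show ?thesis using pair by blast
qed

lemma milliken_taylor_row_ex:
  assumes N: "milliken_taylor_matrix [1, 2] N" and FG: "block_pair F G"
  shows "\<exists>i. \<forall>x. mat_apply N x i = sum x F + 2 * sum x G"
proof -
  have F: "finite F" "F \<noteq> {}" and G: "finite G" "G \<noteq> {}" and less: "\<And>i j. i \<in> F \<Longrightarrow> j \<in> G \<Longrightarrow> i < j"
    using FG by (auto simp: block_pair_def)
  have disj: "F \<inter> G = {}" using less by blast
  define a :: "nat \<Rightarrow> rat" where "a n = (if n \<in> F then 1 else if n \<in> G then 2 else 0)" for n
  have supp: "{n. a n \<noteq> 0} = F \<union> G" by (auto simp: a_def)
  have "map a (sorted_list_of_set F) = map (\<lambda>_. 1) (sorted_list_of_set F)"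
    using F by (intro map_cong) (simp_all add: a_def)
  moreover have "map a (sorted_list_of_set G) = map (\<lambda>_. 2) (sorted_list_of_set G)"
    using G disj by (intro map_cong) (auto simp: a_def)
  ultimately have "map a (sorted_list_of_set (F \<union> G)) = replicate (card F) 1 @ replicate (card G) 2"
    using F G less by (simp add: sorted_list_of_set_append map_replicate_const)
  then have "compressed_form a = [1, 2]"
    using F G by (simp add: compressed_form_def supp remdups_adj_append' remdups_adj_replicate)
  then have "a \<in> range N"
    using N F G supp unfolding milliken_taylor_matrix_def finitely_supported_def by (auto simp: a_def)
  then obtain i where i: "N i = a" by auto
  have "mat_apply N x i = sum x F + 2 * sum x G" for x
  proof -
    have "mat_apply N x i = (\<Sum>j\<in>F \<union> G. of_rat (a j) * x j)"
      unfolding mat_apply_def i using supp by simp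
    also have "\<dots> = (\<Sum>j\<in>F. of_rat (a j) * x j) + (\<Sum>j\<in>G. of_rat (a j) * x j)"
      using F G disj by (intro sum.union_disjoint)
    also have "(\<Sum>j\<in>F. of_rat (a j) * x j) = sum x F" by (simp add: a_def)
    also have "(\<Sum>j\<in>G. of_rat (a j) * x j) = (\<Sum>j\<in>G. 2 * x j)"
      using disj by (intro sum.cong) (auto simp: a_def)
    finally show ?thesis by (simp add: sum_distrib_left)
  qed
  then show ?thesis by blast
qed

lemma mat_apply_block_diag:
  "mat_apply (block_diag M N) x (Inl i) = mat_apply M (x \<circ> Inl) i"
  "mat_apply (block_diag M N) x (Inr k) = mat_apply N (x \<circ> Inr) k"
proof -
  have "j \<in> {j. block_diag M N (Inl i) j \<noteq> 0} \<longleftrightarrow> j \<in> Inl ` {j. M i j \<noteq> 0}" for j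
    by (cases j) auto
  then have supp: "{j. block_diag M N (Inl i) j \<noteq> 0} = Inl ` {j. M i j \<noteq> 0}" by (rule set_eqI)
  show "mat_apply (block_diag M N) x (Inl i) = mat_apply M (x \<circ> Inl) i"
    unfolding mat_apply_def supp by (simp add: sum.reindex)
  have "j \<in> {j. block_diag M N (Inr k) j \<noteq> 0} \<longleftrightarrow> j \<in> Inr ` {j. N k j \<noteq> 0}" for j
    by (cases j) auto
  then have supp: "{j. block_diag M N (Inr k) j \<noteq> 0} = Inr ` {j. N k j \<noteq> 0}" by (rule set_eqI)
  show "mat_apply (block_diag M N) x (Inr k) = mat_apply N (x \<circ> Inr) k"
    unfolding mat_apply_def supp by (simp add: sum.reindex)
qed

context semigroup_near_zero
begin

lemma finite_sums_matrix_ipr: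
  assumes "finite_sums_matrix M"
  shows "ipr_near_zero S M"
  unfolding ipr_near_zero_def
proof (intro allI impI)
  fix \<chi> :: "real \<Rightarrow> nat" and \<epsilon> :: real
  assume "finite (\<chi> ` S) \<and> 0 < \<epsilon>"
  then obtain x c where xS: "\<forall>j. x j \<in> S" and x: "\<And>F. finite F \<and> F \<noteq> {} \<Longrightarrow>
      sum x F \<in> S \<inter> {0<..<\<epsilon>} \<and> \<chi> (sum (x :: nat \<Rightarrow> real) F) = c"
    using finite_sums_near_zero by metis
  have "mat_apply M x i \<in> S \<inter> {0<..<\<epsilon>} \<and> \<chi> (mat_apply M x i) = c" for i
    using finite_sums_row[OF assms, of i] x by metis
  then show "\<exists>x. (\<forall>j. x j \<in> S) \<and> (\<forall>i. mat_apply M x i \<in> S \<inter> {0<..<\<epsilon>}) \<and>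
      (\<exists>c. \<forall>i. \<chi> (mat_apply M x i) = c)"
    using xS by metis
qed

lemma milliken_taylor_matrix_ipr:
  assumes "milliken_taylor_matrix [1, 2] N"
  shows "ipr_near_zero S N"
  unfolding ipr_near_zero_def
proof (intro allI impI)
  fix \<chi> :: "real \<Rightarrow> nat" and \<epsilon> :: real
  assume "finite (\<chi> ` S) \<and> 0 < \<epsilon>"
  then obtain x c where xS: "\<forall>j. x j \<in> S" and x: "\<And>F G. block_pair F G \<Longrightarrow>
      sum x F + 2 * sum x G \<in> S \<inter> {0<..<\<epsilon>} \<and>
      \<chi> (sum (x :: nat \<Rightarrow> real) F + 2 * sum x G) = c"
    using milliken_taylor_near_zero by metis
  have "mat_apply N x i \<in> S \<inter> {0<..<\<epsilon>} \<and> \<chi> (mat_apply N x i) = c" for i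
    using milliken_taylor_row[OF assms, of i] x by metis
  then show "\<exists>x. (\<forall>j. x j \<in> S) \<and> (\<forall>i. mat_apply N x i \<in> S \<inter> {0<..<\<epsilon>}) \<and>
      (\<exists>c. \<forall>i. \<chi> (mat_apply N x i) = c)"
    using xS by metis
qed

end

section \<open>Binary expansions of dyadic numbers\<close>

lemma dyadic_pos_scaled:
  assumes "z \<in> dyadic_pos"
  shows "\<exists>(t::int) (m::nat). 0 < m \<and> z * 2 powi t = real m"
proof -
  obtain m :: int and t :: nat where z: "z = of_int m / 2 ^ t" and "0 < z"
    using assms by (auto simp: dyadic_pos_def dyadic_def)
  then have "0 < m" by (simp add: zero_less_divide_iff)
  moreover have "z * 2 powi (int t) = real (nat m)" using \<open>0 < m\<close> by (simp add: z)
  ultimately show ?thesis by (intro exI[of _ "int t"] exI[of _ "nat m"]) simp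
qed

lemma dyadic_pos_pos: "z \<in> dyadic_pos \<Longrightarrow> 0 < z"
  by (simp add: dyadic_pos_def)

lemma dyadic_pos_add:
  assumes "u \<in> dyadic_pos" "v \<in> dyadic_pos" shows "u + v \<in> dyadic_pos"
proof -
  obtain k l :: int and s t :: nat where uv: "u = of_int k / 2 ^ s" "v = of_int l / 2 ^ t"
    using assms by (auto simp: dyadic_pos_def dyadic_def)
  have "u + v = of_int (k * 2 ^ t + l * 2 ^ s) / 2 ^ (s + t)"
    unfolding uv by (simp add: field_simps power_add)
  then have "u + v \<in> dyadic" unfolding dyadic_def by blast
  moreover have "0 < u + v" using assms by (simp add: dyadic_pos_pos add_pos_pos)
  ultimately show ?thesis by (simp add: dyadic_pos_def)
qed

lemma dyadic_pos_double: "u \<in> dyadic_pos \<Longrightarrow> 2 * u \<in> dyadic_pos"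
  using dyadic_pos_add[of u u] by simp

lemma dyadic_pos_semigroup: "semigroup_near_zero dyadic_pos"
proof
  show "\<exists>x\<in>dyadic_pos. x < \<epsilon>" if pos: "0 < \<epsilon>" for \<epsilon>
  proof -
    obtain n where "(1 / 2) ^ n < \<epsilon>" using real_arch_pow_inv[OF pos, of "1 / 2"] by auto
    moreover have "(1 / 2) ^ n \<in> dyadic_pos"
    proof -
      have "(1 / 2 :: real) ^ n = of_int 1 / 2 ^ n" by (simp add: power_one_over)
      then have "(1 / 2 :: real) ^ n \<in> dyadic" unfolding dyadic_def by blast
      then show ?thesis by (simp add: dyadic_pos_def)
    qed
    ultimately show ?thesis by (rule bexI)
  qed
qed (simp_all add: dyadic_pos_pos dyadic_pos_add)

text \<open>
  The places of the digits 1 in the binary expansion, where place \<open>i\<close> has weight \<open>2\<^sup>-\<^sup>i\<close>. Larger places are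
  less significant.
\<close>

definition ones :: "real \<Rightarrow> int set" where
  "ones z = {i. odd \<lfloor>z * 2 powi i\<rfloor>}"

definition places :: "real \<Rightarrow> int list" where
  "places z = sorted_list_of_set (ones z)"

text \<open>
  For \<open>z = m / 2\<^sup>t\<close> with \<open>m\<close> odd, the last digit sits at place \<open>t\<close>; a factor 2 of \<open>m\<close> lowers \<open>t\<close>.
\<close>

lemma ones_nonempty_scaled:
  "0 < m \<Longrightarrow> z * 2 powi t = real m \<Longrightarrow> ones z \<noteq> {}"
proof (induction m arbitrary: t rule: less_induct)
  case (less m)
  show ?case
  proof (cases "odd m")
    case True
    then have "t \<in> ones z" using less.prems by (simp add: ones_def)
    then show ?thesis by auto
  next
    case False
    then obtain k where k: "m = 2 * k" by (auto elim: evenE)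
    have "z * 2 powi (t - 1) = real k" using less.prems(2) by (simp add: k power_int_diff)
    then show ?thesis using less.IH[of k "t - 1"] less.prems(1) k by simp
  qed
qed

lemma floor_scale_down:
  fixes z :: real
  shows "\<lfloor>z * 2 powi (t - int n)\<rfloor> = \<lfloor>z * 2 powi t\<rfloor> div 2 ^ n"
proof -
  have e: "z * 2 powi (t - int n) = z * 2 powi t / of_int (2 ^ n)" by (simp add: power_int_diff)
  show ?thesis unfolding e by (rule floor_divide_real_eq_div) simp
qed

lemma even_scale_up:
  fixes z :: real
  assumes "z * 2 powi t = of_int k" "t < i"
  shows "\<exists>l. z * 2 powi i = of_int (2 * l)"
proof -
  define n where "n = nat (i - t - 1)"
  have i: "i = t + (int n + 1)" using assms(2) by (simp add: n_def)
  have "(2::real) powi i = 2 powi t * 2 powi (int n + 1)" unfolding i by (rule power_int_add) simp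
  then have "z * 2 powi i = of_int k * 2 powi (int n + 1)" by (simp add: mult.assoc flip: assms(1))
  also have "\<dots> = of_int (2 * (k * 2 ^ n))" by (simp add: power_int_add)
  finally show ?thesis by (rule exI)
qed

lemma ones_le:
  assumes "z * 2 powi t = of_int k" "i \<in> ones z" shows "i \<le> t"
proof (rule ccontr)
  assume "\<not> i \<le> t"
  then obtain l where "z * 2 powi i = of_int (2 * l)" using even_scale_up[OF assms(1), of i] by auto
  then have "\<lfloor>z * 2 powi i\<rfloor> = 2 * l" by (simp only: floor_of_int)
  then show False using assms(2) by (simp add: ones_def)
qed

lemma ones_gt:
  assumes "0 < z" "z * 2 powi t < 1" "i \<in> ones z" shows "t < i"
proof (rule ccontr)
  assume "\<not> t < i"
  then have "(2::real) powi i \<le> 2 powi t" by (intro power_int_increasing) auto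
  then have "z * 2 powi i \<le> z * 2 powi t" using assms(1) by (intro mult_left_mono) auto
  moreover have "0 \<le> z * 2 powi i" using assms(1) by simp
  ultimately have "\<lfloor>z * 2 powi i\<rfloor> = 0" using assms(2) by (simp add: floor_eq_iff)
  then show False using assms(3) by (simp add: ones_def)
qed

lemma ones_finite_nonempty:
  assumes "z \<in> dyadic_pos" shows "finite (ones z)" "ones z \<noteq> {}"
proof -
  obtain t :: int and m :: nat where m: "0 < m" "z * 2 powi t = real m"
    using dyadic_pos_scaled[OF assms] by auto
  then show "ones z \<noteq> {}" by (rule ones_nonempty_scaled)
  obtain n where "z < 2 ^ n" using real_arch_pow[of 2 z] by auto
  then have "z * 2 powi (- int n) < 1" by (simp add: power_int_minus field_simps)
  then have "ones z \<subseteq> {- int n..t}"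
    using ones_gt[OF dyadic_pos_pos[OF assms]] ones_le[of z t "int m"] m(2) by fastforce
  then show "finite (ones z)" by (rule finite_subset) simp
qed

text \<open>
  All digits of \<open>u\<close> are at places up to \<open>t\<close>, those of \<open>v\<close> at later ones.
\<close>

definition far :: "real \<Rightarrow> real \<Rightarrow> bool" where
  "far u v \<longleftrightarrow> (\<exists>t. u * 2 powi t \<in> \<int> \<and> v * 2 powi t < 1)"

lemma far_add_left:
  assumes "far u w" "far v w" shows "far (u + v) w"
proof -
  have up: "z * 2 powi t \<in> \<int>" if "z * 2 powi s \<in> \<int>" "s \<le> t" for z :: real and s t :: int
  proof -
    have "(2::real) powi t = 2 powi s * 2 powi (t - s)" by (simp flip: power_int_add)
    also have "(2::real) powi (t - s) = 2 ^ nat (t - s)" using that(2) by (simp add: power_int_def)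
    finally have e: "z * 2 powi t = z * 2 powi s * 2 ^ nat (t - s)" by simp
    show ?thesis unfolding e by (intro Ints_mult Ints_power Ints_numeral that(1))
  qed
  obtain s t where st: "u * 2 powi s \<in> \<int>" "w * 2 powi s < 1" "v * 2 powi t \<in> \<int>" "w * 2 powi t < 1"
    using assms by (auto simp: far_def)
  have "(u + v) * 2 powi max s t \<in> \<int>"
    using up[OF st(1), of "max s t"] up[OF st(3), of "max s t"] by (simp add: distrib_right)
  moreover have "w * 2 powi max s t < 1" using st by (simp add: max_def)
  ultimately show ?thesis by (auto simp: far_def)
qed

lemma far_double_left: "far u w \<Longrightarrow> far (2 * u) w"
  using far_add_left[of u w u] by simp

lemma far_halve_right:
  assumes "0 < w" "far u (2 * w)" shows "far u w"
proof -
  obtain t where t: "u * 2 powi t \<in> \<int>" "2 * w * 2 powi t < 1" using assms(2) by (auto simp: far_def)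
  have "0 < w * 2 powi t" using assms(1) by simp
  then have "w * 2 powi t < 1" using t(2) by linarith
  then show ?thesis using t(1) by (auto simp: far_def)
qed

text \<open>
  No carries occur: at places up to \<open>t\<close> the summand \<open>v\<close> does not affect the integral part, and at later
  places \<open>u\<close> contributes an even integer.
\<close>

lemma ones_add:
  assumes u: "u * 2 powi t \<in> \<int>" and v: "0 < v" "v * 2 powi t < 1"
  shows "ones (u + v) = ones u \<union> ones v"
proof (rule set_eqI)
  fix i
  obtain k where k: "u * 2 powi t = of_int k" using u by (auto elim: Ints_cases)
  show "i \<in> ones (u + v) \<longleftrightarrow> i \<in> ones u \<union> ones v"
  proof (cases "i \<le> t")
    case True
    then obtain n where i: "i = t - int n" by (metis zle_iff_zadd add_diff_cancel_right')
    have "\<lfloor>(u + v) * 2 powi t\<rfloor> = \<lfloor>u * 2 powi t\<rfloor>"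
      using v by (simp add: distrib_right k floor_eq_iff)
    then have "i \<in> ones (u + v) \<longleftrightarrow> i \<in> ones u"
      unfolding ones_def i mem_Collect_eq floor_scale_down by simp
    moreover have "i \<notin> ones v" using ones_gt[OF v] True by fastforce
    ultimately show ?thesis by simp
  next
    case False
    then obtain l where l: "u * 2 powi i = of_int (2 * l)" using even_scale_up[OF k, of i] by auto
    have "\<lfloor>(u + v) * 2 powi i\<rfloor> = 2 * l + \<lfloor>v * 2 powi i\<rfloor>"
      unfolding distrib_right l by linarith
    then have "i \<in> ones (u + v) \<longleftrightarrow> i \<in> ones v" by (simp add: ones_def)
    moreover have "i \<notin> ones u" using ones_le[OF k] False by auto
    ultimately show ?thesis by simp
  qed
qed

lemma places_add:
  assumes "far u v" "u \<in> dyadic_pos" "v \<in> dyadic_pos"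
  shows "places (u + v) = places u @ places v"
proof -
  obtain t where t: "u * 2 powi t \<in> \<int>" "v * 2 powi t < 1" using assms(1) by (auto simp: far_def)
  obtain k where k: "u * 2 powi t = of_int k" using t(1) by (auto elim: Ints_cases)
  have "i < j" if "i \<in> ones u" "j \<in> ones v" for i j
    using ones_le[OF k that(1)] ones_gt[OF dyadic_pos_pos[OF assms(3)] t(2) that(2)] by simp
  then show ?thesis
    unfolding places_def ones_add[OF t(1) dyadic_pos_pos[OF assms(3)] t(2)]
    using assms ones_finite_nonempty by (intro sorted_list_of_set_append)
qed

lemma places_nonempty: "z \<in> dyadic_pos \<Longrightarrow> places z \<noteq> []"
  using ones_finite_nonempty[of z] by (simp add: places_def)

lemma places_double:
  assumes "z \<in> dyadic_pos"
  shows "places (2 * z) = map (\<lambda>i. i - 1) (places z)"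
proof -
  have e: "2 * z * 2 powi i = z * 2 powi (i + 1)" for i by (simp add: power_int_add)
  have "ones (2 * z) = {i. i + 1 \<in> ones z}" unfolding ones_def e by simp
  also have "\<dots> = (\<lambda>i. i - 1) ` ones z" by force
  also have "\<dots> = set (map (\<lambda>i. i - 1) (places z))"
    using ones_finite_nonempty[OF assms] by (simp add: places_def)
  finally have s: "ones (2 * z) = set (map (\<lambda>i. i - 1) (places z))" .
  have "sorted (map (\<lambda>i. i - 1) (places z))" "distinct (map (\<lambda>i. i - 1) (places z))"
    by (auto simp: places_def distinct_map inj_on_def sorted_map intro: sorted_wrt_mono_rel[of _ "(\<le>)"])
  then show ?thesis
    unfolding places_def[of "2 * z"] s by (rule sorted_list_of_set.idem_if_sorted_distinct)
qed

section \<open>A coloring that separates the two matrices\<close>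

text \<open>
  The arguments \<open>e\<close> and \<open>s\<close> prescribe the parities, with \<open>True\<close> for even, of the left and the right
  member of the neighbouring pairs to be counted.
\<close>

fun gaps :: "bool \<Rightarrow> bool \<Rightarrow> int list \<Rightarrow> nat" where
  "gaps e s (i # j # xs) = (if even i = e \<and> even j = s then 1 else 0) + gaps e s (j # xs)"
| "gaps e s xs = 0"

lemma gaps_append:
  assumes "xs \<noteq> []" "ys \<noteq> []"
  shows "gaps e s (xs @ ys) = gaps e s xs + gaps e s ys +
    (if even (last xs) = e \<and> even (hd ys) = s then 1 else 0)"
  using assms(1)
proof (induction xs rule: induct_list012)
  case (2 i)
  then show ?case using assms(2) by (cases ys) simp_all
next
  case (3 i j xs)
  then show ?case by simp
qed simp

definition starts :: "real \<Rightarrow> bool" where "starts z = even (hd (places z))"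
definition ends :: "real \<Rightarrow> bool" where "ends z = even (last (places z))"

lemma starts_ends_add:
  assumes "far u v" "u \<in> dyadic_pos" "v \<in> dyadic_pos"
  shows "starts (u + v) = starts u" "ends (u + v) = ends v"
    "gaps e s (places (u + v)) = gaps e s (places u) + gaps e s (places v) +
      (if ends u = e \<and> starts v = s then 1 else 0)"
  using places_nonempty[OF assms(2)] places_nonempty[OF assms(3)]
  by (simp_all add: places_add[OF assms] starts_def ends_def gaps_append)

lemma starts_ends_double:
  assumes "z \<in> dyadic_pos"
  shows "starts (2 * z) = (\<not> starts z)" "ends (2 * z) = (\<not> ends z)"
  using places_nonempty[OF assms]
  by (simp_all add: places_double[OF assms] starts_def ends_def hd_map last_map)

text \<open>
  The pairs counted have the last place's parity on the left and the first place's parity on the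
  right. These are the parities at the seam of \<open>u + v\<close> when \<open>u\<close> and \<open>v\<close> have the color of \<open>z\<close>.
\<close>

definition seam_color :: "real \<Rightarrow> bool \<times> bool \<times> bool" where
  "seam_color z = (starts z, ends z, odd (gaps (ends z) (starts z) (places z)))"

text \<open>
  The seam between \<open>u\<close> and \<open>v\<close> is counted, so the three equal counts modulo 2 satisfy
  \<open>n = n + n + 1\<close>.
\<close>

lemma seam_color_sum:
  assumes "far u v" "u \<in> dyadic_pos" "v \<in> dyadic_pos"
    and "seam_color u = (s, e, b)" "seam_color v = (s, e, b)" "seam_color (u + v) = (s, e, b)"
  shows b
  using assms(4-6) starts_ends_add(3)[OF assms(1-3), of e s]
  by (auto simp: seam_color_def)

text \<open>
  The finite sums are bounded, so infinitely many terms cannot stay above a positive number. The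
  index 0 is excluded because in a Milliken-Taylor system it is reserved for the first block.
\<close>

lemma arbitrarily_small_terms:
  fixes y :: "nat \<Rightarrow> real"
  assumes pos: "\<And>i. 0 < y i" and "\<And>F. finite F \<Longrightarrow> F \<noteq> {} \<Longrightarrow> 0 \<notin> F \<Longrightarrow> sum y F < K"
    and "0 < \<delta>"
  shows "\<exists>n>m. y n < \<delta>"
proof (rule ccontr)
  assume "\<not> ?thesis"
  then have ge: "\<delta> \<le> y n" if "m < n" for n using that by force
  obtain k :: nat where k: "K < real k * \<delta>" using reals_Archimedean3[OF assms(3)] by blast
  let ?F = "{m<..m + Suc k}"
  have "real k * \<delta> \<le> real (card ?F) * \<delta>" using assms(3) by simp
  also have "\<dots> \<le> sum y ?F" using ge by (intro sum_bounded_below) auto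
  also have "\<dots> < K" by (intro assms(2)) auto
  finally show False using k by simp
qed

text \<open>
  The digits of the double \<open>2 v\<close> start one place before those of \<open>v\<close>, so asking for \<open>2 v\<close> to be far
  covers both ways in which a later term can occur in a sum.
\<close>

lemma far_subsequence:
  fixes y :: "nat \<Rightarrow> real"
  assumes y: "\<And>i. y i \<in> dyadic_pos"
    and bd: "\<And>F. finite F \<Longrightarrow> F \<noteq> {} \<Longrightarrow> 0 \<notin> F \<Longrightarrow> sum y F < K"
  shows "\<exists>g :: nat \<Rightarrow> nat. strict_mono g \<and> (\<forall>i j. i < j \<longrightarrow> far (y (g i)) (2 * y (g j)))"
proof -
  have step: "\<exists>n>m. \<forall>k\<le>m. far (y k) (2 * y n)" for m
  proof -
    have "\<exists>t. y k * 2 powi t \<in> \<int>" for k using dyadic_pos_scaled[OF y] by (metis Ints_of_nat)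
    then obtain t where t: "\<And>k. y k * 2 powi (t k) \<in> \<int>" by metis
    define d where "d k = 1 / (2 * 2 powi t k :: real)" for k
    obtain n where n: "n > m" "y n < Min (d ` {..m})"
      using arbitrarily_small_terms[of y K "Min (d ` {..m})" m] dyadic_pos_pos[OF y] bd
      by (auto simp: d_def)
    have "far (y k) (2 * y n)" if "k \<le> m" for k
    proof -
      have "y n < d k" using n(2) that by simp
      then have "2 * y n * 2 powi t k < 1" by (simp add: d_def field_simps)
      then show ?thesis using t by (auto simp: far_def)
    qed
    then show ?thesis using n(1) by blast
  qed
  have "\<exists>g. \<forall>i::nat. True \<and> (g i < g (Suc i) \<and> (\<forall>k\<le>g i. far (y k) (2 * y (g (Suc i)))))"
    by (rule dependent_nat_choice) (use step in auto)
  then obtain g where g: "\<And>i. g i < g (Suc i)" "\<And>i k. k \<le> g i \<Longrightarrow> far (y k) (2 * y (g (Suc i)))"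
    by metis
  have mono: "strict_mono g" using g(1) by (simp add: strict_mono_Suc_iff)
  have "far (y (g i)) (2 * y (g j))" if ij: "i < j" for i j
  proof -
    obtain l where l: "j = Suc l" "i \<le> l" using ij by (cases j) auto
    have "g i \<le> g l" using mono l(2) by (simp add: strict_mono_less_eq)
    then show ?thesis using g(2) l(1) by simp
  qed
  then show ?thesis using mono by blast
qed

text \<open>
  Let \<open>N\<close> count modulo 2 the pairs prescribed by the common color. By the choice of parities, no seam
  before a double \<open>2 z\<^sub>k\<close> and no seam after a term \<open>z\<^sub>i\<close> with \<open>i \<ge> 1\<close> is counted, so \<open>N\<close> is additive on
  the sums used below. Comparing \<open>z\<^sub>1 + z\<^sub>2 + 2 z\<^sub>3\<close> with \<open>z\<^sub>1 + 2 z\<^sub>3\<close> shows \<open>N z\<^sub>2 = 0\<close>, comparing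
  \<open>z\<^sub>1 + 2 z\<^sub>2 + 2 z\<^sub>3\<close> with \<open>z\<^sub>1 + 2 z\<^sub>2\<close> shows \<open>N (2 z\<^sub>3) = 0\<close>, and then \<open>N (z\<^sub>2 + 2 z\<^sub>3) = 0\<close>.
\<close>

lemma seam_color_milliken_taylor:
  fixes y :: "nat \<Rightarrow> real"
  assumes y: "\<And>i. y i \<in> dyadic_pos"
    and mt: "\<And>F G. block_pair F G \<Longrightarrow>
      seam_color (sum y F + 2 * sum y G) = (s, e, b) \<and> sum y F + 2 * sum y G < K"
  shows "\<not> b"
proof -
  have "sum y F < K" if F: "finite F" "F \<noteq> {}" "0 \<notin> F" for F
  proof -
    have "block_pair {0} F" using F by (auto simp: block_pair_def intro: gr0I)
    then have "y 0 + 2 * sum y F < K" using mt by force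
    moreover have "0 \<le> sum y F" using dyadic_pos_pos[OF y] by (simp add: sum_nonneg less_imp_le)
    ultimately show ?thesis using dyadic_pos_pos[OF y, of 0] by linarith
  qed
  from far_subsequence[OF y this] obtain g :: "nat \<Rightarrow> nat" where g: "strict_mono g"
    and fg: "\<And>i j. i < j \<Longrightarrow> far (y (g i)) (2 * y (g j))" by auto
  define z where "z i = y (g i)" for i
  have zD: "z i \<in> dyadic_pos" "2 * z i \<in> dyadic_pos" for i
    using y dyadic_pos_double by (auto simp: z_def)
  have far2: "far (z i) (2 * z j)" if "i < j" for i j using fg[OF that] by (simp add: z_def)
  have far1: "far (z i) (z j)" if "i < j" for i j
    using far_halve_right[OF dyadic_pos_pos[OF zD(1)] far2[OF that]] .
  have gl: "g i < g j \<longleftrightarrow> i < j" "g i = g j \<longleftrightarrow> i = j" for i j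
    by (simp_all add: strict_mono_less[OF g] strict_mono_eq[OF g])
  have c2: "seam_color (z i + 2 * z j) = (s, e, b)" if "i < j" for i j
    using mt[of "{g i}" "{g j}"] that by (simp add: block_pair_def gl z_def)
  have c211: "seam_color (z i + z j + 2 * z k) = (s, e, b)" if "i < j" "j < k" for i j k
    using mt[of "{g i, g j}" "{g k}"] that by (simp add: block_pair_def gl z_def)
  have c122: "seam_color (z i + 2 * z j + 2 * z k) = (s, e, b)" if "i < j" "j < k" for i j k
    using mt[of "{g i}" "{g j, g k}"] that by (simp add: block_pair_def gl z_def algebra_simps)
  define N where "N u = gaps e s (places u)" for u
  have N: "odd (N u) = b" if "seam_color u = (s, e, b)" for u
    using that by (auto simp: seam_color_def N_def)
  have start: "starts (2 * z i) \<noteq> s" for i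
    using c2[of i "Suc i"] starts_ends_add(1)[OF far2[of i "Suc i"] zD]
    by (simp add: seam_color_def starts_ends_double(1)[OF zD(1)])
  \<comment> \<open>The color fixes the last place of a term only if another term precedes it, hence Suc.\<close>
  have "end": "ends (z (Suc i)) \<noteq> e" for i
    using c2[of i "Suc i"] starts_ends_add(2)[OF far2[of i "Suc i"] zD]
    by (auto simp: seam_color_def starts_ends_double(2)[OF zD(1)])
  have N2: "N (u + 2 * z k) = N u + N (2 * z k)" if "far u (2 * z k)" "u \<in> dyadic_pos" for u k
    using starts_ends_add(3)[OF that zD(2)] start by (simp add: N_def)
  have f: "far (z 1 + z 2) (2 * z 3)" "far (z 1 + 2 * z 2) (2 * z 3)"
    by (intro far_add_left far_double_left far2; simp)+
  have "N (z 1 + z 2) = N (z 1) + N (z 2)"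
    using starts_ends_add(3)[OF far1 zD(1) zD(1), of 1 2] "end"[of 0] by (simp add: N_def)
  then have "odd (N (z 1) + N (z 2) + N (2 * z 3)) = b"
    using N[OF c211[of 1 2 3]] N2[OF f(1)] dyadic_pos_add zD by simp
  moreover have "odd (N (z 1) + N (2 * z 3)) = b"
    using N[OF c2[of 1 3]] N2[OF far2[of 1 3]] zD by simp
  moreover have "odd (N (z 1 + 2 * z 2) + N (2 * z 3)) = b"
    using N[OF c122[of 1 2 3]] N2[OF f(2)] dyadic_pos_add zD by simp
  moreover have "odd (N (z 1 + 2 * z 2)) = b" using N[OF c2[of 1 2]] by simp
  moreover have "odd (N (z 2) + N (2 * z 3)) = b"
    using N[OF c2[of 2 3]] N2[OF far2[of 2 3]] zD by simp
  ultimately show ?thesis by auto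
qed

section \<open>The block diagonal matrix and central sets\<close>

lemma seam_color_finite_sums:
  fixes u :: "nat \<Rightarrow> real"
  assumes uD: "\<And>i. u i \<in> dyadic_pos"
    and fs: "\<And>F. finite F \<Longrightarrow> F \<noteq> {} \<Longrightarrow> seam_color (sum u F) = (s, e, b) \<and> sum u F < K"
  shows b
proof -
  obtain g :: "nat \<Rightarrow> nat" where g: "strict_mono g" "\<And>i j. i < j \<Longrightarrow> far (u (g i)) (2 * u (g j))"
    using far_subsequence[of u K] uD fs by metis
  have "far (u (g 0)) (u (g 1))"
    using far_halve_right[OF dyadic_pos_pos[OF uD] g(2)] by simp
  moreover have "g 0 < g 1" using g(1) by (simp add: strict_mono_less)
  ultimately show b
    using seam_color_sum[of "u (g 0)" "u (g 1)" s e b] uD fs[of "{g 0}"] fs[of "{g 1}"]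
      fs[of "{g 0, g 1}"] by simp
qed

lemma block_diag_not_ipr:
  assumes "finite_sums_matrix M" and "milliken_taylor_matrix [1, 2] N"
  shows "\<not> ipr_near_zero dyadic_pos (block_diag M N)"
proof
  assume ipr: "ipr_near_zero dyadic_pos (block_diag M N)"
  have "finite (range (to_nat \<circ> seam_color))"
    by (metis finite_class.finite_UNIV finite_imageI image_comp finite_subset subset_UNIV)
  then have "finite ((to_nat \<circ> seam_color) ` dyadic_pos)"
    by (rule finite_subset[rotated]) auto
  then obtain x k where xD: "\<And>j. x j \<in> dyadic_pos"
    and lt: "\<And>i. mat_apply (block_diag M N) x i < 1"
    and k: "\<And>i. (to_nat \<circ> seam_color) (mat_apply (block_diag M N) x i) = k"
    using ipr[unfolded ipr_near_zero_def, rule_format, of "to_nat \<circ> seam_color" 1] by auto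
  obtain s e b :: bool where "from_nat k = (s, e, b)" by (metis prod_cases3)
  then have color: "seam_color (mat_apply (block_diag M N) x i) = (s, e, b)" for i
    using k[of i] by (metis comp_apply from_nat_to_nat)
  define u v where "u = x \<circ> Inl" and "v = x \<circ> Inr"
  have uD: "u i \<in> dyadic_pos" "v i \<in> dyadic_pos" for i using xD by (simp_all add: u_def v_def)
  have rows: "mat_apply (block_diag M N) x (Inl i) = mat_apply M u i"
    "mat_apply (block_diag M N) x (Inr i) = mat_apply N v i" for i
    by (simp_all add: mat_apply_block_diag u_def v_def)
  have "seam_color (sum u F) = (s, e, b) \<and> sum u F < 1" if "finite F" "F \<noteq> {}" for F
    using finite_sums_row_ex[OF assms(1) that] color lt rows(1) by metis
  then have b using seam_color_finite_sums[of u s e b 1] uD(1) by metis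
  moreover have "seam_color (sum v F + 2 * sum v G) = (s, e, b) \<and> sum v F + 2 * sum v G < 1"
    if "block_pair F G" for F G
    using milliken_taylor_row_ex[OF assms(2) that] color lt rows(2) by metis
  then have "\<not> b" using seam_color_milliken_taylor[of v s e b 1] uD(2) by metis
  ultimately show False by simp
qed

text \<open>
  A color class \<open>C\<close> in a minimal idempotent \<open>p\<close>, cut down to \<open>(0,1)\<close> to bound the finite sums, is
  central. Since \<open>p = p + p\<close>, it contains \<open>u\<close>, \<open>v\<close> and \<open>u + v\<close> with \<open>v\<close> beyond the last digit of \<open>u\<close>, which
  forces the parity that \<open>seam_color_milliken_taylor\<close> forbids.
\<close>

lemma milliken_taylor_not_centrally_ipr:
  assumes "milliken_taylor_matrix [1, 2] N"
  shows "\<not> centrally_ipr_near_zero dyadic_pos N"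
proof
  assume cen: "centrally_ipr_near_zero dyadic_pos N"
  interpret semigroup_near_zero dyadic_pos by (rule dyadic_pos_semigroup)
  obtain p where p: "p \<in> zero_plus dyadic_pos" "minimal_idempotent dyadic_pos p"
    using minimal_idempotent_exists by auto
  have pb: "p \<in> beta dyadic_pos" using p(1) by (rule zero_plus_beta)
  have pp: "beta_add dyadic_pos p p = p" using p(2) by (simp add: minimal_idempotent_def)
  obtain c where c: "{x \<in> dyadic_pos. seam_color x = c} \<in> p"
    using ultrafilter_finite_coloring[OF pb, of seam_color] by auto
  obtain s e b :: bool where seb: "c = (s, e, b)" by (metis prod_cases3)
  define C where "C = {x \<in> dyadic_pos. x < 1} \<inter> {x \<in> dyadic_pos. seam_color x = c}"
  have C: "C \<in> p" unfolding C_def by (intro ultrafilter_Int[OF pb] zero_plus_interval[OF p(1)] c) simp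
  have "central_near_zero dyadic_pos C"
    unfolding central_near_zero_def using C p(2) by (auto simp: C_def)
  then obtain x where xD: "\<And>j. x j \<in> dyadic_pos" and x: "\<And>i. mat_apply N x i \<in> C"
    using cen unfolding centrally_ipr_near_zero_def by metis
  have "seam_color (sum x F + 2 * sum x G) = (s, e, b) \<and> sum x F + 2 * sum x G < 1"
    if FG: "block_pair F G" for F G
  proof -
    obtain i where "mat_apply N x i = sum x F + 2 * sum x G"
      using milliken_taylor_row_ex[OF assms FG] by auto
    then show ?thesis using x[of i] by (simp add: C_def seb)
  qed
  then have "\<not> b" using seam_color_milliken_taylor[of x s e b 1] xD by metis
  obtain u where u: "u \<in> C" "{v \<in> dyadic_pos. u + v \<in> C} \<in> p"
    using ultrafilter_nonempty[OF pb idempotent_return[OF pb pp C]] by auto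
  have uD: "u \<in> dyadic_pos" using u(1) by (simp add: C_def)
  obtain t :: int and m :: nat where t: "u * 2 powi t = real m" using dyadic_pos_scaled[OF uD] by auto
  have small: "{v \<in> dyadic_pos. v < 1 / 2 powi t} \<in> p" by (intro zero_plus_interval[OF p(1)]) simp
  obtain v where v: "v \<in> C" "u + v \<in> C" "v < 1 / 2 powi t"
    using ultrafilter_nonempty[OF pb ultrafilter_Int[OF pb C ultrafilter_Int[OF pb u(2) small]]] by auto
  have "v * 2 powi t < 1" using v(3) by (simp add: field_simps)
  then have "far u v" unfolding far_def using t by (metis Ints_of_nat)
  then have b using seam_color_sum[of u v s e b] u(1) v(1,2) by (simp add: C_def seb)
  then show False using \<open>\<not> b\<close> by simp
qed

theorem theorem2p2:
  fixes M N :: "(nat, nat) rmat"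
  assumes "finite_sums_matrix M"
    and "milliken_taylor_matrix [1, 2] N"
  shows "(ipr_near_zero dyadic_pos M \<and> ipr_near_zero dyadic_pos N) \<and>
         \<not> ipr_near_zero dyadic_pos (block_diag M N) \<and>
         \<not> centrally_ipr_near_zero dyadic_pos N"
proof -
  interpret semigroup_near_zero dyadic_pos by (rule dyadic_pos_semigroup)
  show ?thesis
    using finite_sums_matrix_ipr[OF assms(1)] milliken_taylor_matrix_ipr[OF assms(2)]
      block_diag_not_ipr[OF assms] milliken_taylor_not_centrally_ipr[OF assms(2)] by blast
qed

end
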